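(* For any finite $k\ge2$: (1) if there is an Ł$_{k_{n\vee}}$ proof of a formula $A$ in $n$ steps, then there is an $\mathcal{H}\text{Łuk}_k$ proof of $A$ in $O(n\cdot\alpha(n))$ steps, where $\alpha$ is the inverse Ackermann function; (2) if there is an Ł$_{k_{n\vee}}$ proof of $A$ in $n$ steps in which assumptions are opened $m$ times, then (for each fixed $i\ge0$) there is an $\mathcal{H}\text{Łuk}_k$ proof of $A$ in $O(n\cdot m\log^{( *i)}m)$ steps.
   Context: Formulas are built from variables with $\wedge,\vee,\supset,\neg$. Ł$_k$ ($k$-valued Łukasiewicz logic): valuations into $\{0,\frac{1}{k-1},\ldots,1\}$ with $v(\neg A)=1-v(A)$, $v(A\wedge B)=\min$, $v(A\vee B)=\max$, $v(A\supset B)=\min(1,1-v(A)+v(B))$. $\mathcal{H}\text{Łuk}_k$ is a fixed sound and implicationally complete Frege system for Ł$_k$ (finitely many axiom schemas, sole rule modus ponens); steps = length of a proof. Ł$_{k_{n\vee}}$: a proof is a sequence of lines, each a formula with a context (finite sequence of open assumptions, initially empty); a line is available to a later one if its context is an initial subsequence of the later one's and it lies in no closed block; lines are: $\mathcal{H}\text{Łuk}_k$ axiom instances (context unchanged); opening an assumption $C$ (context $\Gamma*\langle C\rangle$, $\Gamma$ the context of the last available line); modus ponens from available lines; $\vee_{ne}$: from available $C\vee D$ in context $\Gamma$, a block opened by $C$ ending in $E$ and a subsequent block opened by $D$ ending in $E$, close both blocks (their lines become unavailable) and write $E$ in context $\Gamma$. A proof of $A$ ends with $A$ in empty context; steps =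 lines. $\log^{( *0)}m=\log_2 m$; $\log^{( *(i+1))}m$ is the least number of applications of $\log^{( *i)}$ bringing $m$ to at most $1$; constants in (2) may depend on $i$. *)

theory Defs
  imports Complex_Main "HOL-Library.Sublist"
begin

section \<open>Formulas and finite-valued Lukasiewicz semantics\<close>

datatype formula =
    Var nat
  | Neg formula
  | Conj formula formula
  | Disj formula formula
  | Imp formula formula

definition truth_values :: "nat \<Rightarrow> real set" where
  "truth_values k = {real j / real (k - 1) | j. j \<le> k - 1}"

definition valuation :: "nat \<Rightarrow> (nat \<Rightarrow> real) \<Rightarrow> bool" where
  "valuation k v \<longleftrightarrow> (\<forall>x. v x \<in> truth_values k)"

fun eval_fm :: "(nat \<Rightarrow> real) \<Rightarrow> formula \<Rightarrow> real" where
  "eval_fm v (Var x) = v x"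
| "eval_fm v (Neg A) = 1 - eval_fm v A"
| "eval_fm v (Conj A B) = min (eval_fm v A) (eval_fm v B)"
| "eval_fm v (Disj A B) = max (eval_fm v A) (eval_fm v B)"
| "eval_fm v (Imp A B) = min 1 (1 - eval_fm v A + eval_fm v B)"

definition entails :: "nat \<Rightarrow> formula set \<Rightarrow> formula \<Rightarrow> bool" where
  "entails k \<Gamma> A \<longleftrightarrow>
     (\<forall>v. valuation k v \<longrightarrow> (\<forall>B\<in>\<Gamma>. eval_fm v B = 1) \<longrightarrow> eval_fm v A = 1)"

section \<open>Frege systems\<close>

fun subst :: "(nat \<Rightarrow> formula) \<Rightarrow> formula \<Rightarrow> formula" where
  "subst \<sigma> (Var x) = \<sigma> x"
| "subst \<sigma> (Neg A) = Neg (subst \<sigma> A)"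
| "subst \<sigma> (Conj A B) = Conj (subst \<sigma> A) (subst \<sigma> B)"
| "subst \<sigma> (Disj A B) = Disj (subst \<sigma> A) (subst \<sigma> B)"
| "subst \<sigma> (Imp A B) = Imp (subst \<sigma> A) (subst \<sigma> B)"

text \<open>An axiom schema is a formula whose variables play the role of metavariables.
  A Frege system with modus ponens as its only rule is given by its set of schemas.\<close>

definition axiom_instances :: "formula set \<Rightarrow> formula set" where
  "axiom_instances Ax = {subst \<sigma> S | \<sigma> S. S \<in> Ax}"

definition frege_proof :: "formula set \<Rightarrow> formula set \<Rightarrow> formula list \<Rightarrow> formula \<Rightarrow> bool" where
  "frege_proof Ax \<Gamma> \<pi> A \<longleftrightarrow> \<pi> \<noteq> [] \<and> last \<pi> = A \<and>
     (\<forall>i < length \<pi>. \<pi> ! i \<in> axiom_instances Ax \<or> \<pi> ! i \<in> \<Gamma> \<or>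
        (\<exists>j < i. \<exists>l < i. \<pi> ! l = Imp (\<pi> ! j) (\<pi> ! i)))"

definition sound :: "nat \<Rightarrow> formula set \<Rightarrow> bool" where
  "sound k Ax \<longleftrightarrow>
     (\<forall>\<Gamma> \<pi> A. finite \<Gamma> \<longrightarrow> frege_proof Ax \<Gamma> \<pi> A \<longrightarrow> entails k \<Gamma> A)"

definition implicationally_complete :: "nat \<Rightarrow> formula set \<Rightarrow> bool" where
  "implicationally_complete k Ax \<longleftrightarrow>
     (\<forall>\<Gamma> A. finite \<Gamma> \<longrightarrow> entails k \<Gamma> A \<longrightarrow> (\<exists>\<pi>. frege_proof Ax \<Gamma> \<pi> A))"

definition frege_system :: "nat \<Rightarrow> formula set \<Rightarrow> bool" where
  "frege_system k Ax \<longleftrightarrow> finite Ax \<and> sound k Ax \<and> implicationally_complete k Ax"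

section \<open>Nested proofs with disjunction elimination\<close>

text \<open>A line is a context together with a formula.  Next to the list of lines we carry the set
  \<open>X\<close> of the positions that lie in closed blocks.\<close>

type_synonym line = "formula list \<times> formula"

definition available :: "line list \<Rightarrow> nat set \<Rightarrow> formula list \<Rightarrow> formula \<Rightarrow> bool" where
  "available P X \<Gamma> A \<longleftrightarrow>
     (\<exists>i < length P. i \<notin> X \<and> prefix (fst (P ! i)) \<Gamma> \<and> snd (P ! i) = A)"

text \<open>\<open>nested Ax \<Gamma> P X Q Y m\<close>: the lines \<open>P\<close> with closed positions \<open>X\<close> can be continued, working in
  context \<open>\<Gamma>\<close>, to the lines \<open>Q\<close> with closed positions \<open>Y\<close>, and the continuation opens \<open>m\<close>
  assumptions.  Every block it opens is closed again, so it both starts and stops in context \<open>\<Gamma>\<close>.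
  In the rule \<open>or_elim\<close> the first block occupies the positions from \<open>length P\<^sub>0\<close> up to
  \<open>length P\<^sub>1\<close> (exclusive) and the second one those from \<open>length P\<^sub>2\<close> up to \<open>length P\<^sub>3\<close>;
  the continuations from \<open>P\<^sub>1\<close> to \<open>P\<^sub>2\<close> and from \<open>P\<^sub>3\<close> to \<open>P\<^sub>4\<close> are (possibly empty) runs of lines
  in context \<open>\<Gamma>\<close> next to the blocks.\<close>

inductive nested ::
  "formula set \<Rightarrow> formula list \<Rightarrow> line list \<Rightarrow> nat set \<Rightarrow> line list \<Rightarrow> nat set \<Rightarrow> nat \<Rightarrow> bool"
  for Ax :: "formula set" where
  start: "nested Ax \<Gamma> P X P X 0"
| axiom_line: "\<lbrakk>nested Ax \<Gamma> P X Q Y m; A \<in> axiom_instances Ax\<rbrakk>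
    \<Longrightarrow> nested Ax \<Gamma> P X (Q @ [(\<Gamma>, A)]) Y m"
| modus_ponens: "\<lbrakk>nested Ax \<Gamma> P X Q Y m; available Q Y \<Gamma> B; available Q Y \<Gamma> (Imp B A)\<rbrakk>
    \<Longrightarrow> nested Ax \<Gamma> P X (Q @ [(\<Gamma>, A)]) Y m"
| or_elim: "\<lbrakk>nested Ax \<Gamma> P X P\<^sub>0 X\<^sub>0 m\<^sub>0;
     nested Ax (\<Gamma> @ [C]) (P\<^sub>0 @ [(\<Gamma> @ [C], C)]) X\<^sub>0 P\<^sub>1 X\<^sub>1 m\<^sub>1; snd (last P\<^sub>1) = E;
     nested Ax \<Gamma> P\<^sub>1 X\<^sub>1 P\<^sub>2 X\<^sub>2 m\<^sub>2;
     nested Ax (\<Gamma> @ [D]) (P\<^sub>2 @ [(\<Gamma> @ [D], D)]) X\<^sub>2 P\<^sub>3 X\<^sub>3 m\<^sub>3; snd (last P\<^sub>3) = E;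
     nested Ax \<Gamma> P\<^sub>3 X\<^sub>3 P\<^sub>4 X\<^sub>4 m\<^sub>4;
     available P\<^sub>4 X\<^sub>4 \<Gamma> (Disj C D)\<rbrakk>
    \<Longrightarrow> nested Ax \<Gamma> P X (P\<^sub>4 @ [(\<Gamma>, E)])
          (X\<^sub>4 \<union> {length P\<^sub>0..<length P\<^sub>1} \<union> {length P\<^sub>2..<length P\<^sub>3})
          (m\<^sub>0 + m\<^sub>1 + m\<^sub>2 + m\<^sub>3 + m\<^sub>4 + 2)"

text \<open>\<open>nested_proof Ax P m A\<close>: the lines \<open>P\<close> form a proof of \<open>A\<close> that opens assumptions \<open>m\<close> times.\<close>

definition nested_proof :: "formula set \<Rightarrow> line list \<Rightarrow> nat \<Rightarrow> formula \<Rightarrow> bool" where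
  "nested_proof Ax P m A \<longleftrightarrow> (\<exists>X. nested Ax [] [] {} P X m) \<and> P \<noteq> [] \<and> last P = ([], A)"

section \<open>Slowly growing functions\<close>

fun log_star :: "nat \<Rightarrow> real \<Rightarrow> real" where
  "log_star 0 x = log 2 x"
| "log_star (Suc i) x = real (LEAST j. (log_star i ^^ j) x \<le> 1)"

fun ackermann :: "nat \<Rightarrow> nat \<Rightarrow> nat" where
  "ackermann 0 n = Suc n"
| "ackermann (Suc m) 0 = ackermann m 1"
| "ackermann (Suc m) (Suc n) = ackermann m (ackermann (Suc m) n)"

text \<open>Restricting to \<open>i \<ge> 1\<close> is the usual convention that makes \<open>\<alpha>\<close> positive everywhere.\<close>

definition inverse_ackermann :: "nat \<Rightarrow> nat" where
  "inverse_ackermann n = (LEAST i. 1 \<le> i \<and> n \<le> ackermann i i)"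

end

theory Submission
  imports Defs
begin

text \<open>
  A line with formula \<open>A\<close> in context \<open>\<Gamma>\<close> is translated to \<open>\<And>\<Gamma> \<Rightarrow> A\<close>, where \<open>X \<Rightarrow> A\<close> is the
  \<open>(k - 1)\<close>-fold iterated Lukasiewicz implication. The only step whose cost is not bounded by a
  constant is moving a formula from a context \<open>\<Delta>\<close> to a longer one \<open>\<Gamma>\<close>, which needs a chain of
  implications from \<open>\<And>\<Gamma>\<close> to \<open>\<And>\<Delta>\<close>. The contexts form a tree, so one has to add few transitive
  edges to a tree such that each node reaches each of its ancestors by a short path.

  For this, take as separators the levels of the tree in a residue class modulo \<open>s\<close> that contains at
  most the fraction \<open>1/s\<close> of the nodes. Link each node to the nearest separator above it, each
  separator to the \<open>s\<close> levels above it, solve the problem for the tree of separators with paths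
  shorter by two, and solve it recursively between the separators. With \<open>s\<close> chosen by an
  Ackermann-like recursion, paths of length \<open>2 * i + 1\<close> cost only \<open>(2 * i + 1) * j\<close> edges per node
  up to height \<open>span_height i j\<close>.

  For the second bound the parent edges alone suffice, because a context has at most \<open>m\<close> formulas
  and \<open>log_star i m \<ge> 1\<close> for \<open>m \<ge> 2\<close>.
\<close>

section \<open>Counting rule applications\<close>

text \<open>Generic in the rule \<open>R\<close>: with \<open>compose_rule\<close> a step adds one
  shortcut edge, with \<open>frege_rule\<close> one line of a Frege proof, so both sizes are counted
  by the same calculus.\<close>

inductive steps :: "('a set \<Rightarrow> 'a \<Rightarrow> bool) \<Rightarrow> nat \<Rightarrow> 'a set \<Rightarrow> 'a set \<Rightarrow> bool"
  for R where
  steps_0: "steps R 0 S S"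
| steps_Suc: "steps R n S T \<Longrightarrow> R T a \<Longrightarrow> steps R (Suc n) S (insert a T)"

text \<open>The upper bound on the count and the inclusion in the result allow weakening in every
  argument once \<open>R\<close> is monotone; derivations can then be glued without tracking exact
  sets.\<close>

definition reach :: "('a set \<Rightarrow> 'a \<Rightarrow> bool) \<Rightarrow> nat \<Rightarrow> 'a set \<Rightarrow> 'a set \<Rightarrow> bool" where
  "reach R n S T \<longleftrightarrow> (\<exists>m\<le>n. \<exists>U. steps R m S U \<and> T \<subseteq> U)"

lemma steps_subset: "steps R n S T \<Longrightarrow> S \<subseteq> T"
  by (induction rule: steps.induct) auto

lemma steps_union:
  assumes "steps R n S T" "mono R"
  shows "steps R n (S \<union> W) (T \<union> W)"
  using assms(1)
proof induction
  case (steps_Suc n S T a)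
  have "R (T \<union> W) a"
    using monoD[OF assms(2), of T "T \<union> W"] steps_Suc.hyps(2) by (auto simp: le_fun_def)
  then show ?case using steps.steps_Suc[OF steps_Suc.IH] by simp
qed (rule steps.steps_0)

lemma steps_trans: "steps R m T U \<Longrightarrow> steps R n S T \<Longrightarrow> steps R (n + m) S U"
  by (induction rule: steps.induct) (auto intro: steps.intros)

lemma reach_refl: "T \<subseteq> S \<Longrightarrow> reach R n S T"
  unfolding reach_def using steps_0 by blast

lemma reach_step: "R S a \<Longrightarrow> reach R 1 S {a}"
  unfolding reach_def using steps_Suc[OF steps_0, of R S a]
  by (metis One_nat_def empty_subsetI insert_mono order_refl)

lemma reach_weaken:
  assumes "reach R n S T" "mono R" "n \<le> n'" "S \<subseteq> S'" "T' \<subseteq> T"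
  shows "reach R n' S' T'"
proof -
  obtain m U where U: "m \<le> n" "steps R m S U" "T \<subseteq> U"
    using assms(1) unfolding reach_def by blast
  have "steps R m (S \<union> S') (U \<union> S')" using steps_union[OF U(2) assms(2)] .
  moreover have "S \<union> S' = S'" using assms(4) by blast
  ultimately have "steps R m S' (U \<union> S')" by simp
  then show ?thesis unfolding reach_def
    using U(1,3) assms(3,5) by (intro exI[of _ m] exI[of _ "U \<union> S'"] conjI) auto
qed

lemma reach_trans:
  assumes "reach R n S T" "reach R m (S \<union> T) U" "mono R"
  shows "reach R (n + m) S (S \<union> T \<union> U)"
proof -
  obtain n' V where V: "n' \<le> n" "steps R n' S V" "T \<subseteq> V"
    using assms(1) unfolding reach_def by blast
  obtain m' W where W: "m' \<le> m" "steps R m' (S \<union> T) W" "U \<subseteq> W"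
    using assms(2) unfolding reach_def by blast
  have "S \<union> T \<union> V = V" using V(3) steps_subset[OF V(2)] by blast
  then have "steps R m' V (W \<union> V)" using steps_union[OF W(2) assms(3), of V] by simp
  from steps_trans[OF this V(2)] have "steps R (n' + m') S (W \<union> V)" .
  then show ?thesis unfolding reach_def using V W steps_subset[OF V(2)]
    by (intro exI[of _ "n' + m'"]) auto
qed

lemma reach_Un:
  assumes "reach R n S T" "reach R m S U" "mono R"
  shows "reach R (n + m) S (T \<union> U)"
proof -
  have "reach R m (S \<union> T) U" using reach_weaken[OF assms(2,3)] by simp
  from reach_trans[OF assms(1) this assms(3)] show ?thesis
    by (rule reach_weaken[OF _ assms(3)]) auto
qed

lemma reach_UN:
  assumes "finite I" "mono R" "\<And>i. i \<in> I \<Longrightarrow> reach R (c i) S (T i)"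
  shows "reach R (\<Sum>i\<in>I. c i) S (\<Union>i\<in>I. T i)"
  using assms(1,3)
proof (induction I)
  case empty
  then show ?case by (simp add: reach_refl)
next
  case (insert i I)
  then have "reach R (c i + (\<Sum>i\<in>I. c i)) S (T i \<union> (\<Union>i\<in>I. T i))"
    by (intro reach_Un[OF _ _ assms(2)]) auto
  then show ?case using insert.hyps by simp
qed

text \<open>Serves to turn each composition of two edges into a derivation of constant length. The
  steps are simulated one after the other, each over the image of what has been reached so
  far.\<close>

lemma reach_transfer:
  assumes "reach R n S T" "mono R'" "\<And>T a. R T a \<Longrightarrow> reach R' c (F ` T) {F a}"
  shows "reach R' (c * n) (F ` S) (F ` T)"
proof -
  have *: "reach R' (c * m) (F ` S) (F ` U)" if "steps R m S U" for m U
    using that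
  proof induction
    case (steps_0 S)
    then show ?case by (simp add: reach_refl)
  next
    case (steps_Suc n S T a)
    have "reach R' c (F ` S \<union> F ` T) {F a}"
      using reach_weaken[OF assms(3)[OF steps_Suc.hyps(2)] assms(2)] by auto
    from reach_trans[OF steps_Suc.IH this assms(2)] show ?case
      by (rule reach_weaken[OF _ assms(2)]) auto
  qed
  obtain m U where U: "m \<le> n" "steps R m S U" "T \<subseteq> U"
    using assms(1) unfolding reach_def by blast
  show ?thesis by (rule reach_weaken[OF *[OF U(2)] assms(2)]) (use U in auto)
qed

section \<open>Shortcut edges in trees\<close>

definition compose_rule :: "('v \<times> 'v) set \<Rightarrow> 'v \<times> 'v \<Rightarrow> bool" where
  "compose_rule S e \<longleftrightarrow> e \<in> S O S"

lemma mono_compose_rule: "mono compose_rule"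
  by (auto simp: mono_def le_fun_def compose_rule_def)

text \<open>The edges from the fixed start are added in order of distance, each from the previous
  one and the next edge of the chain. The first of them is in \<open>S\<close> already; charging a
  step for it keeps the count uniform.\<close>

lemma reach_chain:
  assumes "\<And>t. t < n \<Longrightarrow> (x t, x (Suc t)) \<in> S"
  shows "reach compose_rule n S {(x 0, x t) |t. 0 < t \<and> t \<le> n}"
  using assms
proof (induction n)
  case 0
  then show ?case by (simp add: reach_refl)
next
  case (Suc n)
  let ?T = "{(x 0, x t) |t. 0 < t \<and> t \<le> n}"
  have e: "(x n, x (Suc n)) \<in> S" using Suc.prems by simp
  have "reach compose_rule 1 (S \<union> ?T) {(x 0, x (Suc n))}"
  proof (cases "n = 0")
    case True
    then show ?thesis using e by (intro reach_refl) auto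
  next
    case False
    then have "(x 0, x n) \<in> ?T" by auto
    then show ?thesis using e by (intro reach_step) (auto simp: compose_rule_def)
  qed
  from reach_trans[OF Suc.IH this mono_compose_rule] Suc.prems
  have "reach compose_rule (n + 1) S (S \<union> ?T \<union> {(x 0, x (Suc n))})" by simp
  then show ?case
    by (rule reach_weaken[OF _ mono_compose_rule]) (auto simp: le_Suc_eq)
qed

section \<open>Trees of lists, their levels and their separators\<close>

definition width :: "'a list set \<Rightarrow> nat \<Rightarrow> nat" where
  "width T d = card {u \<in> T. length u = d}"

text \<open>A node is a list and its ancestors are its prefixes. The function \<open>g\<close>
  selects depths, level \<open>q\<close> being depth \<open>g q\<close>, so that the tree of
  separators and the blocks between separators are instances of the same notion.\<close>

definition parent_edges ::
  "'a list set \<Rightarrow> (nat \<Rightarrow> nat) \<Rightarrow> nat \<Rightarrow> ('a list \<times> 'a list) set" where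
  "parent_edges T g h =
     {(u, take (g q) u) | u q. u \<in> T \<and> length u = g (Suc q) \<and> Suc q < h}"

text \<open>The reflexive closure turns paths of exactly \<open>f\<close> edges into paths of at
  most \<open>f\<close> edges.\<close>

definition spans ::
  "'a list set \<Rightarrow> (nat \<Rightarrow> nat) \<Rightarrow> nat \<Rightarrow> nat \<Rightarrow> ('a list \<times> 'a list) set \<Rightarrow> bool" where
  "spans T g h f E \<longleftrightarrow>
     (\<forall>u\<in>T. \<forall>q<h. \<forall>q'<q. length u = g q \<longrightarrow> (u, take (g q') u) \<in> (E\<^sup>=) ^^ f)"

lemma reach_levels:
  fixes g :: "nat \<Rightarrow> nat"
  assumes "finite T" "mono R"
    and "\<And>u q. u \<in> T \<Longrightarrow> q < h \<Longrightarrow> length u = g q \<Longrightarrow> reach R c S (F q u)"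
  shows "reach R (c * (\<Sum>q<h. width T (g q))) S
           (\<Union>q<h. \<Union>u\<in>{u \<in> T. length u = g q}. F q u)"
proof -
  have "reach R (\<Sum>u\<in>{u \<in> T. length u = g q}. c) S (\<Union>u\<in>{u \<in> T. length u = g q}. F q u)"
    if "q < h" for q
    using assms that by (intro reach_UN[OF _ assms(2)]) auto
  then have "reach R (\<Sum>q<h. \<Sum>u\<in>{u \<in> T. length u = g q}. c) S
           (\<Union>q<h. \<Union>u\<in>{u \<in> T. length u = g q}. F q u)"
    by (intro reach_UN[OF finite_lessThan assms(2)]) simp
  then show ?thesis by (simp add: width_def sum_distrib_left mult.commute)
qed

lemma take_take_mono:
  fixes g :: "nat \<Rightarrow> nat"
  shows "strict_mono g \<Longrightarrow> a \<le> b \<Longrightarrow> take (g a) (take (g b) u) = take (g a) u"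
  using strict_mono_less_eq[of g a b] by simp

lemma length_take_mono:
  fixes g :: "nat \<Rightarrow> nat"
  shows "strict_mono g \<Longrightarrow> a \<le> b \<Longrightarrow> length u = g b \<Longrightarrow> length (take (g a) u) = g a"
  using strict_mono_less_eq[of g a b] by simp

lemma parent_edges_take:
  assumes "\<And>u d. u \<in> T \<Longrightarrow> take d u \<in> T" "strict_mono g"
    and "u \<in> T" "length u = g q" "q < h" "Suc p \<le> q"
  shows "(take (g (Suc p)) u, take (g p) u) \<in> parent_edges T g h"
proof -
  have "take (g p) (take (g (Suc p)) u) = take (g p) u"
    using assms(2) by (intro take_take_mono) auto
  moreover have "length (take (g (Suc p)) u) = g (Suc p)"
    using assms by (intro length_take_mono) auto
  ultimately show ?thesis unfolding parent_edges_def using assms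
    by (intro CollectI exI[of _ "take (g (Suc p)) u"] exI[of _ p]) auto
qed

lemma reach_ancestors:
  assumes "\<And>u d. u \<in> T \<Longrightarrow> take d u \<in> T" "strict_mono g"
    and "u \<in> T" "length u = g q" "q < h"
  shows "reach compose_rule n (parent_edges T g h)
           {(u, take (g q') u) |q'. q \<le> q' + n \<and> q' < q}"
proof -
  \<comment> \<open>Close to the root there are fewer than \<open>n\<close> levels above
    \<open>u\<close>.\<close>
  define m where "m = min n q"
  have "reach compose_rule m (parent_edges T g h)
          {(take (g (q - 0)) u, take (g (q - t)) u) |t. 0 < t \<and> t \<le> m}"
  proof (rule reach_chain)
    fix t assume "t < m"
    then have "Suc (q - Suc t) = q - t" "q - t \<le> q" by (auto simp: m_def)
    with parent_edges_take[OF assms, of "q - Suc t"]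
    show "(take (g (q - t)) u, take (g (q - Suc t)) u) \<in> parent_edges T g h" by simp
  qed
  then show ?thesis
  proof (rule reach_weaken[OF _ mono_compose_rule])
    show "{(u, take (g q') u) |q'. q \<le> q' + n \<and> q' < q} \<subseteq>
      {(take (g (q - 0)) u, take (g (q - t)) u) |t. 0 < t \<and> t \<le> m}"
    proof clarify
      fix q' assume "q \<le> q' + n" "q' < q"
      then show "\<exists>t. (u, take (g q') u) = (take (g (q - 0)) u, take (g (q - t)) u) \<and> 0 < t \<and> t \<le> m"
        using assms(4) by (intro exI[of _ "q - q'"]) (auto simp: m_def)
    qed
  qed (auto simp: m_def)
qed

text \<open>Levels are treated from the root downwards: the edge of \<open>u\<close> is its parent
  edge followed by the edge of its parent, so one composition per node suffices. A separator is
  linked to the previous separator.\<close>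

lemma reach_nearest_separator:
  assumes T: "finite T" "\<And>u d. u \<in> T \<Longrightarrow> take d u \<in> T" and g: "strict_mono g" and "n \<le> h"
  shows "reach compose_rule (\<Sum>q<n. width T (g q)) (parent_edges T g h)
    {(u, take (g (r + y * s)) u) |u q y.
       u \<in> T \<and> length u = g q \<and> r + y * s < q \<and> q \<le> r + y * s + s \<and> q < n}"
  using assms(4)
proof (induction n)
  case 0
  then show ?case by (simp add: reach_refl)
next
  case (Suc n)
  let ?S = "\<lambda>n. {(u, take (g (r + y * s)) u) |u q y.
       u \<in> T \<and> length u = g q \<and> r + y * s < q \<and> q \<le> r + y * s + s \<and> q < n}"
  let ?L = "{u \<in> T. length u = g n}"
  let ?F = "\<lambda>u. {(u, take (g (r + y * s)) u) |y. r + y * s < n \<and> n \<le> r + y * s + s}"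
  have "reach compose_rule (\<Sum>u\<in>?L. 1) (parent_edges T g h \<union> ?S n) (\<Union>u\<in>?L. ?F u)"
  proof (rule reach_UN)
    fix u assume "u \<in> ?L"
    then have u: "u \<in> T" "length u = g n" by auto
    show "reach compose_rule 1 (parent_edges T g h \<union> ?S n) (?F u)"
    proof (cases "\<exists>y. r + y * s < n \<and> n \<le> r + y * s + s")
      case False
      then show ?thesis by (intro reach_refl) auto
    next
      case True
      then obtain y where y: "r + y * s < n" "n \<le> r + y * s + s" by blast
      \<comment> \<open>The nearest separator level is unique, so \<open>?F u\<close> is a single
        edge and costs one step.\<close>
      have uniq: "y' = (n - 1 - r) div s" if "r + y' * s < n" "n \<le> r + y' * s + s" for y'
        using that by (intro div_nat_eqI[symmetric]) (auto simp: algebra_simps)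
      have F: "?F u = {(u, take (g (r + y * s)) u)}"
      proof -
        have "y' = y" if "r + y' * s < n" "n \<le> r + y' * s + s" for y'
          using uniq[OF y] uniq[OF that] by simp
        then show ?thesis using y by blast
      qed
      from y have "n \<noteq> 0" by simp
      then obtain p where p: "n = Suc p" by (cases n) auto
      have "(take (g (Suc p)) u, take (g p) u) \<in> parent_edges T g h"
        using u p Suc.prems T g by (intro parent_edges_take[where q = n]) auto
      then have e: "(u, take (g p) u) \<in> parent_edges T g h" using u p by simp
      \<comment> \<open>If the parent is itself a separator, the parent edge is the wanted one;
        otherwise it is composed with the edge that the parent has received before.\<close>
      show ?thesis
      proof (cases "p = r + y * s")
        case True
        then show ?thesis using e F by (intro reach_refl) auto
      next
        case False
        then have "r + y * s < p" "p \<le> r + y * s + s" using y p by auto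
        moreover have "take (g (r + y * s)) (take (g p) u) = take (g (r + y * s)) u"
          using calculation g by (intro take_take_mono) auto
        moreover have "length (take (g p) u) = g p"
          using g u p by (intro length_take_mono[where b = n]) auto
        ultimately have "(take (g p) u, take (g (r + y * s)) u) \<in> ?S n"
          using T u p by (intro CollectI exI[of _ "take (g p) u"] exI[of _ p] exI[of _ y]) auto
        then have "compose_rule (parent_edges T g h \<union> ?S n) (u, take (g (r + y * s)) u)"
          unfolding compose_rule_def using e by (blast intro: relcompI)
        from reach_step[of compose_rule, OF this] F show ?thesis by simp
      qed
    qed
  qed (use T mono_compose_rule in auto)
  from reach_trans[OF Suc.IH this mono_compose_rule] Suc.prems
  have "reach compose_rule ((\<Sum>q<n. width T (g q)) + (\<Sum>u\<in>?L. 1)) (parent_edges T g h)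
    (parent_edges T g h \<union> ?S n \<union> (\<Union>u\<in>?L. ?F u))" by simp
  then show ?case
  proof (rule reach_weaken[OF _ mono_compose_rule])
    show "?S (Suc n) \<subseteq> parent_edges T g h \<union> ?S n \<union> (\<Union>u\<in>?L. ?F u)"
    proof
      fix e assume "e \<in> ?S (Suc n)"
      then obtain u q y where e: "e = (u, take (g (r + y * s)) u)" "u \<in> T" "length u = g q"
        "r + y * s < q" "q \<le> r + y * s + s" "q < Suc n" by blast
      show "e \<in> parent_edges T g h \<union> ?S n \<union> (\<Union>u\<in>?L. ?F u)"
      proof (cases "q = n")
        case True
        with e have "u \<in> ?L" "e \<in> ?F u" by auto
        then show ?thesis by blast
      next
        case False
        with e have "q < n" by simp
        with e have "e \<in> ?S n" by blast
        then show ?thesis by blast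
      qed
    qed
  qed (simp_all add: width_def)
qed

text \<open>The \<open>s\<close> residue classes partition the levels; if each exceeded the average,
  their sum would exceed the total.\<close>

lemma residue_class_le_average:
  fixes w :: "nat \<Rightarrow> nat"
  assumes "s > 0"
  obtains r where "r < s" "s * (\<Sum>q | q < h \<and> q mod s = r. w q) \<le> (\<Sum>q<h. w q)"
proof -
  let ?c = "\<lambda>r. \<Sum>q | q < h \<and> q mod s = r. w q"
  have eq: "(\<Sum>q<h. w q) = (\<Sum>r<s. ?c r)"
    using assms sum.group[of "{..<h}" "{..<s}" "\<lambda>q. q mod s" w] by (simp add: image_subset_iff)
  have "\<exists>r<s. s * ?c r \<le> (\<Sum>q<h. w q)"
  proof (rule ccontr)
    assume "\<not> ?thesis"
    then have "(\<Sum>r<s. \<Sum>q<h. w q) < (\<Sum>r<s. s * ?c r)"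
      using assms by (intro sum_strict_mono) (auto simp: not_le)
    then have "s * (\<Sum>q<h. w q) < s * (\<Sum>r<s. ?c r)"
      by (simp only: sum_constant card_lessThan sum_distrib_left[symmetric] of_nat_id)
    then show False using eq by simp
  qed
  then show ?thesis using that by blast
qed

section \<open>An Ackermann-like height function\<close>

text \<open>The recursion follows the construction. Linking to all ancestors handles
  \<open>Suc j\<close> levels. In the last equation a block has
  \<open>s = span_height (Suc i) j\<close> levels and \<open>span_height i s\<close> separator
  levels are allowed, whence the product.\<close>

fun span_height :: "nat \<Rightarrow> nat \<Rightarrow> nat" where
  "span_height 0 j = Suc j"
| "span_height (Suc i) 0 = 1"
| "span_height (Suc i) (Suc j) =
     span_height (Suc i) j * span_height i (span_height (Suc i) j)"

lemma span_height_gt: "Suc j \<le> span_height i j"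
proof (induction i j rule: span_height.induct)
  case (3 i j)
  let ?s = "span_height (Suc i) j"
  have "Suc (Suc j) \<le> 1 * span_height i ?s" using 3 by linarith
  also have "\<dots> \<le> ?s * span_height i ?s" using 3 by (intro mult_right_mono) linarith+
  finally show ?case by simp
qed auto

text \<open>The Ackermann recursion for \<open>span_height\<close>, as an inequality; the dropped
  factor is at least 1.\<close>

lemma span_height_step: "span_height i (span_height (Suc i) j) \<le> span_height (Suc i) (Suc j)"
  using span_height_gt[of j "Suc i"] by (cases "span_height (Suc i) j") auto

lemma span_height_mono: "j \<le> j' \<Longrightarrow> span_height i j \<le> span_height i j'"
proof (rule lift_Suc_mono_le[of "span_height i"])
  show "span_height i n \<le> span_height i (Suc n)" for n
  proof (cases i)
    case (Suc i')
    have "span_height i n \<le> span_height i' (span_height i n)"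
      using span_height_gt[of "span_height i n" i'] by simp
    then show ?thesis using span_height_step[of i' n] Suc by simp
  qed simp
qed

text \<open>Induction along the Ackermann recursion, with \<open>span_height_step\<close> in place
  of its third equation. The shift by 3 serves the second equation: it leads to
  \<open>span_height i 4\<close>, and 4 is at most \<open>span_height (Suc i) 2\<close>.\<close>

lemma ackermann_le_span_height: "ackermann i j + 3 \<le> span_height i (j + 3)"
proof (induction i j rule: ackermann.induct)
  case (2 i)
  have "4 \<le> span_height (Suc i) 2"
  proof -
    have "2 \<le> span_height (Suc i) 1" using span_height_gt[of 1 "Suc i"] by simp
    moreover from this have "3 \<le> span_height i (span_height (Suc i) 1)"
      using span_height_gt[of "span_height (Suc i) 1" i] by simp
    ultimately have "2 * 3 \<le> span_height (Suc i) 1 * span_height i (span_height (Suc i) 1)"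
      by (intro mult_le_mono)
    then show ?thesis by (simp add: numeral_2_eq_2)
  qed
  then have "span_height i 4 \<le> span_height i (span_height (Suc i) 2)" by (rule span_height_mono)
  also have "\<dots> \<le> span_height (Suc i) 3"
    using span_height_step[of i 2] by (simp add: numeral_3_eq_3)
  finally show ?case using 2 by simp
next
  case (3 i j)
  have "ackermann (Suc i) (Suc j) + 3 \<le> span_height i (ackermann (Suc i) j + 3)"
    using 3 by simp
  also have "\<dots> \<le> span_height i (span_height (Suc i) (j + 3))" using 3 by (intro span_height_mono)
  also have "\<dots> \<le> span_height (Suc i) (Suc j + 3)" using span_height_step[of i "j + 3"] by simp
  finally show ?case .
qed simp

lemma ackermann_gt: "Suc j \<le> ackermann i j"
  by (induction i j rule: ackermann.induct) auto

lemma ackermann_1_gt: "Suc i \<le> ackermann i 1"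
proof (induction i)
  case (Suc i)
  have "Suc (ackermann (Suc i) 0) \<le> ackermann i (ackermann (Suc i) 0)" by (rule ackermann_gt)
  then show ?case using Suc by simp
qed simp

text \<open>Fixes the number of edges per node: one level higher in the hierarchy,
  \<open>j = 4\<close> is enough, because \<open>span_height (Suc i) 3\<close> already exceeds
  \<open>i + 2\<close>.\<close>

lemma ackermann_diagonal_le: "ackermann i i \<le> span_height (Suc i) 4"
proof -
  have "i + 3 \<le> span_height (Suc i) 3"
    using ackermann_le_span_height[of "Suc i" 0] ackermann_1_gt[of i] by simp
  then have "span_height i (i + 3) \<le> span_height i (span_height (Suc i) 3)"
    by (rule span_height_mono)
  also have "\<dots> \<le> span_height (Suc i) 4"
    using span_height_step[of i 3] by (simp add: eval_nat_numeral)
  finally show ?thesis using ackermann_le_span_height[of i i] by simp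
qed

section \<open>Short paths to all ancestors\<close>

lemma relpow_reflcl_refl: "(u, u) \<in> (E\<^sup>=) ^^ n"
  by (induction n) auto

lemma relpow_reflcl_mono: "E \<subseteq> E' \<Longrightarrow> (E\<^sup>=) ^^ n \<subseteq> (E'\<^sup>=) ^^ n"
  by (induction n) (auto intro!: relcomp_mono)

lemma relpow_reflcl_le: "n \<le> m \<Longrightarrow> (E\<^sup>=) ^^ n \<subseteq> (E\<^sup>=) ^^ m"
  by (rule lift_Suc_mono_le) auto

text \<open>Base of the construction: on \<open>Suc j\<close> levels a node has at most
  \<open>j\<close> proper ancestors and is linked to each directly.\<close>

lemma all_ancestor_shortcuts:
  assumes T: "finite T" "\<And>u d. u \<in> T \<Longrightarrow> take d u \<in> T" and g: "strict_mono g" and h: "h \<le> Suc j"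
  shows "\<exists>E. reach compose_rule (j * (\<Sum>q<h. width T (g q))) (parent_edges T g h) E
    \<and> spans T g h 1 E"
proof -
  let ?F = "\<lambda>q u. {(u, take (g q') u) |q'. q \<le> q' + j \<and> q' < q}"
  let ?E = "\<Union>q<h. \<Union>u\<in>{u \<in> T. length u = g q}. ?F q u"
  have "reach compose_rule (j * (\<Sum>q<h. width T (g q))) (parent_edges T g h) ?E"
    by (rule reach_levels[OF T(1) mono_compose_rule]) (rule reach_ancestors[OF T(2) g])
  moreover have "spans T g h 1 ?E"
    unfolding spans_def
  proof (intro ballI allI impI)
    fix u q q' assume a: "u \<in> T" "q < h" "q' < q" "length u = g q"
    then have "(u, take (g q') u) \<in> ?F q u" using h by auto
    then have "(u, take (g q') u) \<in> ?E" using a by blast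
    then show "(u, take (g q') u) \<in> (?E\<^sup>=) ^^ 1" by simp
  qed
  ultimately show ?thesis by blast
qed

text \<open>Handles a node and an ancestor with a separator between them: go to the last separator
  \<open>x\<close> at or above the node, by \<open>f\<close> edges to the first separator
  \<open>x'\<close> below the ancestor, and up by one edge. The edges \<open>E\<close> may cost
  \<open>c * s\<close> per separator because at most the fraction \<open>1/s\<close> of the nodes
  are separators.\<close>

lemma separator_shortcuts:
  assumes T: "finite T" "\<And>u d. u \<in> T \<Longrightarrow> take d u \<in> T" and g: "strict_mono g"
    and s: "s > 0" and r: "r < s"
    and w: "s * (\<Sum>q | q < h \<and> q mod s = r. width T (g q)) \<le> (\<Sum>q<h. width T (g q))"
    and h': "h' = (h + s - 1 - r) div s"
    and E: "reach compose_rule (c * s * (\<Sum>x<h'. width T (g (r + x * s))))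
              (parent_edges T (\<lambda>x. g (r + x * s)) h') E"
    and E_spans: "spans T (\<lambda>x. g (r + x * s)) h' f E"
  shows "\<exists>E'. reach compose_rule ((c + 2) * (\<Sum>q<h. width T (g q))) (parent_edges T g h) E' \<and>
    (\<forall>u\<in>T. \<forall>q<h. \<forall>q' x x'. length u = g q \<longrightarrow>
       q' < r + x' * s \<longrightarrow> r + x' * s \<le> q' + s \<longrightarrow> x' \<le> x \<longrightarrow> r + x * s \<le> q \<longrightarrow> q < r + x * s + s \<longrightarrow>
       (u, take (g q') u) \<in> (E'\<^sup>=) ^^ (f + 2))"
proof -
  let ?N = "\<Sum>q<h. width T (g q)"
  let ?g = "\<lambda>x. g (r + x * s)"
  let ?P = "parent_edges T g h"
  let ?M = "\<Sum>x<h'. width T (?g x)"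
  let ?near = "{(u, take (g (r + y * s)) u) |u q y.
       u \<in> T \<and> length u = g q \<and> r + y * s < q \<and> q \<le> r + y * s + s \<and> q < h}"
  let ?F = "\<lambda>x u. {(u, take (g q') u) |q'. r + x * s \<le> q' + s \<and> q' < r + x * s}"
  let ?top = "\<Union>x<h'. \<Union>u\<in>{u \<in> T. length u = ?g x}. ?F x u"
  let ?E = "?near \<union> ?top \<union> E"
  \<comment> \<open>\<open>h'\<close> counts the separator levels: it is \<open>(h - r) / s\<close>
    rounded up, and 0 if \<open>h \<le> r\<close>.\<close>
  have lt_h': "x < h' \<longleftrightarrow> r + x * s < h" for x
  proof -
    have "x < h' \<longleftrightarrow> Suc x * s \<le> h + s - 1 - r"
      unfolding h' using s by (simp add: less_eq_div_iff_mult_less_eq Suc_le_eq[symmetric])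
    also have "\<dots> \<longleftrightarrow> r + x * s < h" using r by auto
    finally show ?thesis .
  qed
  have gS: "strict_mono ?g"
    using s g by (auto simp: strict_mono_def)
  have "?M = (\<Sum>q\<in>(\<lambda>x. r + x * s) ` {..<h'}. width T (g q))"
    using s by (subst sum.reindex) (auto simp: inj_on_def)
  also have "\<dots> \<le> (\<Sum>q | q < h \<and> q mod s = r. width T (g q))"
  proof (rule sum_mono2)
    show "(\<lambda>x. r + x * s) ` {..<h'} \<subseteq> {q. q < h \<and> q mod s = r}"
      using r lt_h' by (intro image_subsetI) simp
  qed simp_all
  finally have M: "s * ?M \<le> ?N" using w by (meson le_trans mult_le_mono2)
  have near: "reach compose_rule ?N ?P ?near"
    by (rule reach_nearest_separator[OF T g order_refl])
  have top: "reach compose_rule (s * ?M) ?P ?top"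
  proof (rule reach_levels[OF T(1) mono_compose_rule])
    fix u x assume "u \<in> T" "x < h'" "length u = ?g x"
    then show "reach compose_rule s ?P (?F x u)" using lt_h'[of x]
      by (intro reach_ancestors[OF T(2) g]) auto
  qed
  \<comment> \<open>The nearest separator above a separator is the previous one, so the edges that
    \<open>E\<close> starts from have been built in \<open>?near\<close>.\<close>
  have "parent_edges T ?g h' \<subseteq> ?near"
  proof
    fix e assume "e \<in> parent_edges T ?g h'"
    then obtain u x where e: "e = (u, take (?g x) u)" "u \<in> T" "length u = ?g (Suc x)" "Suc x < h'"
      unfolding parent_edges_def by blast
    have "r + x * s < r + Suc x * s" "r + Suc x * s \<le> r + x * s + s" "r + Suc x * s < h"
      using s lt_h'[of "Suc x"] e(4) by auto
    with e show "e \<in> ?near" by blast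
  qed
  then have "reach compose_rule (c * s * ?M) (?P \<union> (?near \<union> ?top)) E"
    by (intro reach_weaken[OF E mono_compose_rule]) auto
  with reach_Un[OF near top mono_compose_rule]
  have "reach compose_rule (?N + s * ?M + c * s * ?M) ?P (?P \<union> (?near \<union> ?top) \<union> E)"
    using mono_compose_rule by (rule reach_trans)
  \<comment> \<open>Each node pays 1 for \<open>?near\<close>, each separator \<open>s\<close> for
    \<open>?top\<close> and \<open>c * s\<close> for \<open>E\<close>; by \<open>M\<close> this
    amounts to \<open>1 + 1 + c\<close> per node.\<close>
  moreover have "?N + s * ?M + c * s * ?M \<le> (c + 2) * ?N"
  proof -
    have "c * (s * ?M) \<le> c * ?N" using M by (rule mult_le_mono2)
    with M have "?N + s * ?M + c * (s * ?M) \<le> ?N + ?N + c * ?N" by linarith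
    also have "\<dots> = (c + 2) * ?N" by (simp add: algebra_simps)
    finally show ?thesis by (simp add: mult.assoc)
  qed
  ultimately have cost: "reach compose_rule ((c + 2) * ?N) ?P ?E"
    by (rule reach_weaken[OF _ mono_compose_rule]) auto
  have "(u, take (g q') u) \<in> (?E\<^sup>=) ^^ (f + 2)"
    if a: "u \<in> T" "q < h" "length u = g q" and x': "q' < r + x' * s" "r + x' * s \<le> q' + s"
      and x: "x' \<le> x" "r + x * s \<le> q" "q < r + x * s + s" for u q q' x x'
  proof -
    let ?u1 = "take (?g x) u" and ?u2 = "take (?g x') u"
    have x'x: "r + x' * s \<le> r + x * s" using x(1) by simp
    have u1: "?u1 \<in> T" "length ?u1 = ?g x"
      using T(2)[OF a(1)] length_take_mono[OF g x(2) a(3)] by auto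
    have u2: "?u2 \<in> T" "length ?u2 = ?g x'"
      using T(2)[OF a(1)] length_take_mono[OF g le_trans[OF x'x x(2)] a(3)] by auto
    have xh: "x < h'" "x' < h'" unfolding lt_h' using a(2) x(2) x'x by linarith+
    have 1: "(u, ?u1) \<in> ?E\<^sup>="
    proof (cases "r + x * s = q")
      case True
      then show ?thesis using a by simp
    next
      case False
      then have "(u, ?u1) \<in> ?near" using a x
        by (intro CollectI exI[of _ u] exI[of _ q] exI[of _ x]) auto
      then show ?thesis by blast
    qed
    have "(?u1, ?u2) \<in> (E\<^sup>=) ^^ f"
    proof (cases "x' = x")
      case True
      then show ?thesis by (simp add: relpow_reflcl_refl)
    next
      case False
      with x have "x' < x" by simp
      then have "(?u1, take (?g x') ?u1) \<in> (E\<^sup>=) ^^ f"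
        using E_spans u1 xh unfolding spans_def by blast
      moreover have "take (?g x') ?u1 = ?u2" by (rule take_take_mono[OF g x'x])
      ultimately show ?thesis by simp
    qed
    then have 2: "(?u1, ?u2) \<in> (?E\<^sup>=) ^^ f" using relpow_reflcl_mono[of E ?E f] by blast
    have "(?u2, take (g q') ?u2) \<in> ?F x' ?u2" using x' by blast
    then have "(?u2, take (g q') ?u2) \<in> ?top" using u2 xh by blast
    moreover have "take (g q') ?u2 = take (g q') u" using g x' by (intro take_take_mono) auto
    ultimately have 3: "(?u2, take (g q') u) \<in> ?E\<^sup>=" by simp
    have "(u, ?u2) \<in> (?E\<^sup>=) ^^ Suc f" using 1 2 by (rule relpow_Suc_I2)
    from relpow_Suc_I[OF this 3] have "(u, take (g q') u) \<in> (?E\<^sup>=) ^^ Suc (Suc f)" .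
    then show ?thesis by simp
  qed
  then show ?thesis using cost by blast
qed

text \<open>Induction along \<open>span_height\<close>: the separator tree has the parameters
  \<open>i\<close> and \<open>s\<close>, the blocks have \<open>Suc i\<close> and \<open>j\<close>.
  The edges across blocks cost \<open>2 * i + 3 = 2 * Suc i + 1\<close> per node, which is the
  increase allowed from \<open>j\<close> to \<open>Suc j\<close>.\<close>

lemma ancestor_shortcuts:
  assumes T: "finite T" "\<And>u d. u \<in> T \<Longrightarrow> take d u \<in> T" and "strict_mono g" "h \<le> span_height i j"
  shows "\<exists>E. reach compose_rule ((2 * i + 1) * j * (\<Sum>q<h. width T (g q))) (parent_edges T g h) E
    \<and> spans T g h (2 * i + 1) E"
  using assms(3,4)
proof (induction i j arbitrary: g h rule: span_height.induct)
  case (1 j)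
  from "1.prems"(2) have "h \<le> Suc j" by simp
  from all_ancestor_shortcuts[OF T "1.prems"(1) this] show ?case by simp
next
  case (2 i)
  then have "spans T g h f {}" for f by (auto simp: spans_def)
  then show ?case using reach_refl by blast
next
  case (3 i j)
  note g = "3.prems"(1)
  define s where "s = span_height (Suc i) j"
  let ?N = "\<Sum>q<h. width T (g q)"
  let ?P = "parent_edges T g h"
  have s: "s > 0" using span_height_gt[of j "Suc i"] by (simp add: s_def)
  from residue_class_le_average[OF s, of "\<lambda>q. width T (g q)" h]
  obtain r where r: "r < s"
    and w: "s * (\<Sum>q | q < h \<and> q mod s = r. width T (g q)) \<le> ?N" by blast
  define h' where "h' = (h + s - 1 - r) div s"
  \<comment> \<open>Among at most \<open>span_height i s * s\<close> levels, any offset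
    \<open>r\<close> leaves at most \<open>span_height i s\<close> separator levels.\<close>
  have "h' \<le> (span_height i s * s + (s - 1)) div s"
    using "3.prems"(2) s unfolding h'_def
    by (intro div_le_mono) (simp add: s_def[symmetric] mult.commute)
  also have "\<dots> = span_height i s" using s by (intro div_nat_eqI) (auto simp: algebra_simps)
  finally have "h' \<le> span_height i s" .
  moreover have "strict_mono (\<lambda>x. g (r + x * s))" using s g by (auto simp: strict_mono_def)
  ultimately obtain ES where ES:
    "reach compose_rule ((2 * i + 1) * s * (\<Sum>x<h'. width T (g (r + x * s))))
       (parent_edges T (\<lambda>x. g (r + x * s)) h') ES"
    "spans T (\<lambda>x. g (r + x * s)) h' (2 * i + 1) ES"
    using "3.IH"(3)[of "\<lambda>x. g (r + x * s)" h'] unfolding s_def by blast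
  from separator_shortcuts[OF T g s r w h'_def ES] obtain E1 where
    E1: "reach compose_rule ((2 * i + 1 + 2) * ?N) ?P E1"
    and E1_spans: "\<And>u q q' x x'. u \<in> T \<Longrightarrow> q < h \<Longrightarrow> length u = g q \<Longrightarrow>
       q' < r + x' * s \<Longrightarrow> r + x' * s \<le> q' + s \<Longrightarrow> x' \<le> x \<Longrightarrow> r + x * s \<le> q \<Longrightarrow> q < r + x * s + s \<Longrightarrow>
       (u, take (g q') u) \<in> (E1\<^sup>=) ^^ (2 * i + 1 + 2)" by blast
  \<comment> \<open>Block \<open>y\<close> consists of the levels from \<open>lo y\<close> to \<open>lo (y + 1)\<close>; truncated subtraction
    makes \<open>lo 0 = 0\<close>.\<close>
  define lo where "lo y = r + y * s - s" for y
  have lo_0: "lo 0 = 0" and lo_Suc: "lo (Suc y) = r + y * s" for y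
    using r by (auto simp: lo_def)
  have lo_mono: "lo y \<le> lo (Suc y)" "lo (Suc y) \<le> lo y + s" for y
    using r by (auto simp: lo_def)
  \<comment> \<open>Truncated subtraction makes the blocks that start at or beyond \<open>h\<close>
    empty.\<close>
  define len where "len y = min h (lo (Suc y)) - lo y" for y
  have "\<exists>E. reach compose_rule ((2 * Suc i + 1) * j * (\<Sum>q<len y. width T (g (lo y + q))))
        (parent_edges T (\<lambda>q. g (lo y + q)) (len y)) E
      \<and> spans T (\<lambda>q. g (lo y + q)) (len y) (2 * Suc i + 1) E" for y
  proof (rule "3.IH"(1))
    show "strict_mono (\<lambda>q. g (lo y + q))" using g by (auto simp: strict_mono_def)
    show "len y \<le> span_height (Suc i) j" using lo_mono[of y] by (auto simp: len_def s_def[symmetric])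
  qed
  then obtain EB where EB:
    "\<And>y. reach compose_rule ((2 * Suc i + 1) * j * (\<Sum>q<len y. width T (g (lo y + q))))
        (parent_edges T (\<lambda>q. g (lo y + q)) (len y)) (EB y)"
    "\<And>y. spans T (\<lambda>q. g (lo y + q)) (len y) (2 * Suc i + 1) (EB y)"
    by metis
  \<comment> \<open>The blocks partition the levels, so the sums telescope; below,
    \<open>Suc h\<close> blocks are seen to cover all levels under \<open>h\<close>.\<close>
  have blocks: "(\<Sum>y<Y. \<Sum>q<len y. width T (g (lo y + q))) = (\<Sum>q<min h (lo Y). width T (g q))" for Y
  proof (induction Y)
    case (Suc Y)
    have "(\<Sum>q<len Y. width T (g (lo Y + q))) = (\<Sum>q=lo Y..<lo Y + len Y. width T (g q))"
      using sum.shift_bounds_nat_ivl[of "\<lambda>q. width T (g q)" 0 "lo Y" "len Y"]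
      by (simp add: lessThan_atLeast0 add.commute)
    moreover have "{min h (lo Y)..<min h (lo (Suc Y))} = {lo Y..<lo Y + len Y}"
      using lo_mono(1)[of Y] by (auto simp: len_def)
    ultimately have "(\<Sum>q<len Y. width T (g (lo Y + q))) =
        (\<Sum>q=min h (lo Y)..<min h (lo (Suc Y)). width T (g q))" by simp
    moreover have "min h (lo Y) \<le> min h (lo (Suc Y))" using lo_mono(1)[of Y] by auto
    ultimately show ?case using Suc
      by (simp add: lessThan_atLeast0 sum.atLeastLessThan_concat)
  qed (simp add: lo_0)
  have "h \<le> lo (Suc h)" using s by (simp add: lo_Suc trans_le_add2)
  then have blocks_N: "(\<Sum>y<Suc h. \<Sum>q<len y. width T (g (lo y + q))) = ?N"
    unfolding blocks by (simp add: min_absorb1)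
  have "parent_edges T (\<lambda>q. g (lo y + q)) (len y) \<subseteq> ?P" for y
    by (force simp: parent_edges_def len_def)
  then have "reach compose_rule ((2 * Suc i + 1) * j * (\<Sum>q<len y. width T (g (lo y + q)))) ?P (EB y)"
    for y by (intro reach_weaken[OF EB(1) mono_compose_rule]) auto
  then have "reach compose_rule (\<Sum>y<Suc h. (2 * Suc i + 1) * j * (\<Sum>q<len y. width T (g (lo y + q))))
      ?P (\<Union>y<Suc h. EB y)"
    by (intro reach_UN[OF finite_lessThan mono_compose_rule])
  then have "reach compose_rule ((2 * Suc i + 1) * j * ?N) ?P (\<Union>y<Suc h. EB y)"
    by (simp only: sum_distrib_left[symmetric] blocks_N)
  from reach_Un[OF E1 this mono_compose_rule]
  have "reach compose_rule ((2 * Suc i + 1) * Suc j * ?N) ?P (E1 \<union> (\<Union>y<Suc h. EB y))"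
    by (simp add: algebra_simps)
  moreover have "spans T g h (2 * Suc i + 1) (E1 \<union> (\<Union>y<Suc h. EB y))" (is "spans _ _ _ ?f ?E")
    unfolding spans_def
  proof (intro ballI allI impI)
    fix u q q' assume a: "u \<in> T" "q < h" "q' < q" "length u = g q"
    \<comment> \<open>Adding \<open>s - r\<close> moves the separator levels to multiples of
      \<open>s\<close>, so division yields the number of the block.\<close>
    define y where "y = (q + s - r) div s"
    define y' where "y' = (q' + s - r) div s"
    have lo_div: "lo (p div s) \<le> p - (s - r) \<and> p - (s - r) < lo (Suc (p div s))" if "s - r \<le> p" for p
    proof -
      have "p div s * s \<le> p" "p < p div s * s + s"
        using s dividend_less_times_div[OF s, of p] by (auto simp: mult.commute)
      then show ?thesis unfolding lo_def mult_Suc using that r by linarith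
    qed
    have y: "lo y \<le> q" "q < lo (Suc y)"
      using lo_div[of "q + s - r"] r by (auto simp: y_def)
    have y': "lo y' \<le> q'" "q' < lo (Suc y')"
      using lo_div[of "q' + s - r"] r by (auto simp: y'_def)
    have yy': "y' \<le> y" unfolding y_def y'_def using a by (intro div_le_mono) auto
    show "(u, take (g q') u) \<in> (?E\<^sup>=) ^^ ?f"
    proof (cases "y' = y")
      case True
      have "length u = g (lo y + (q - lo y))" "q - lo y < len y" "q' - lo y < q - lo y"
        using a y y' True by (auto simp: len_def)
      then have "(u, take (g (lo y + (q' - lo y))) u) \<in> ((EB y)\<^sup>=) ^^ ?f"
        using EB(2)[of y] a(1) unfolding spans_def by blast
      moreover have "lo y + (q' - lo y) = q'" using y' True by simp
      ultimately have q': "(u, take (g q') u) \<in> ((EB y)\<^sup>=) ^^ ?f" by simp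
      have "y < Suc h"
      proof -
        have "y \<le> q + 1"
        proof (cases y)
          case (Suc z)
          have "z \<le> z * s" using s by simp
          moreover have "r + z * s \<le> q" using y(1) Suc by (simp add: lo_Suc)
          ultimately show ?thesis using Suc by linarith
        qed simp
        then show ?thesis using a by simp
      qed
      then have "EB y \<subseteq> ?E" by blast
      from subsetD[OF relpow_reflcl_mono[OF this] q'] show ?thesis .
    next
      case False
      with yy' obtain x where x: "y = Suc x" by (cases y) auto
      \<comment> \<open>Separator \<open>x\<close> is the top level of the block of
        \<open>q\<close>, and separator \<open>y'\<close> follows right after the block of
        \<open>q'\<close>.\<close>
      have q': "(u, take (g q') u) \<in> (E1\<^sup>=) ^^ (2 * i + 1 + 2)"
      proof (rule E1_spans[OF a(1,2,4)])
        show "q' < r + y' * s" using y' by (simp add: lo_Suc)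
        show "r + y' * s \<le> q' + s" using y'(1) by (simp add: lo_def)
        show "y' \<le> x" using False yy' x by simp
        show "r + x * s \<le> q" using y(1) x by (simp add: lo_Suc)
        show "q < r + x * s + s" using y(2) x by (simp add: lo_Suc)
      qed
      have "2 * i + 1 + 2 = ?f" by simp
      with q' have "(u, take (g q') u) \<in> (E1\<^sup>=) ^^ ?f" by (simp only:)
      then show ?thesis by (rule subsetD[OF relpow_reflcl_mono[OF Un_upper1]])
    qed
  qed
  ultimately show ?case by blast
qed

section \<open>Finite-valued Lukasiewicz logic and Frege derivations\<close>

lemma truth_values_unit:
  assumes "x \<in> truth_values k" shows "0 \<le> x" "x \<le> 1"
  using assms by (auto simp: truth_values_def divide_le_eq_1)

text \<open>Truth values are multiples of \<open>1 / (k - 1)\<close>, so a value below 1 misses it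
  by at least that much.\<close>

lemma truth_values_less_1:
  assumes "x \<in> truth_values k" "x < 1" "k \<ge> 2"
  shows "1 \<le> real (k - 1) * (1 - x)"
proof -
  obtain j where j: "x = real j / real (k - 1)" using assms by (auto simp: truth_values_def)
  have k: "real (k - 1) > 0" using assms by simp
  then have "real j < real (k - 1)" using assms(2) j by simp
  then have "real (j + 1) \<le> real (k - 1)" unfolding of_nat_le_iff of_nat_less_iff by simp
  then show ?thesis using k j by (simp add: field_simps)
qed

lemma eval_fm_in_truth_values:
  assumes "valuation k v" "k \<ge> 2"
  shows "eval_fm v A \<in> truth_values k"
proof -
  let ?K = "real (k - 1)"
  have K: "?K > 0" using assms by simp
  \<comment> \<open>Numerators are taken as integers so that the differences in negation and
    implication are not truncated.\<close>
  have int: "x \<in> truth_values k \<longleftrightarrow> (\<exists>j::int. x = of_int j / ?K \<and> 0 \<le> j \<and> j \<le> int (k - 1))" for x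
  proof
    assume "x \<in> truth_values k"
    then obtain j where "x = real j / ?K" "j \<le> k - 1" by (auto simp: truth_values_def)
    then show "\<exists>j::int. x = of_int j / ?K \<and> 0 \<le> j \<and> j \<le> int (k - 1)"
      by (intro exI[of _ "int j"]) auto
  next
    assume "\<exists>j::int. x = of_int j / ?K \<and> 0 \<le> j \<and> j \<le> int (k - 1)"
    then obtain j :: int where j: "x = of_int j / ?K" "0 \<le> j" "j \<le> int (k - 1)" by blast
    then have "x = real (nat j) / ?K" "nat j \<le> k - 1" by auto
    then show "x \<in> truth_values k" unfolding truth_values_def by blast
  qed
  show ?thesis
  proof (induction A)
    case (Var x)
    then show ?case using assms by (simp add: valuation_def)
  next
    case (Neg A)
    then obtain j :: int where j: "eval_fm v A = of_int j / ?K" "0 \<le> j" "j \<le> int (k - 1)"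
      unfolding int by blast
    show ?case unfolding int
    proof (intro exI conjI)
      show "eval_fm v (Neg A) = of_int (int (k - 1) - j) / ?K"
        using j K by (simp add: field_simps)
    qed (use j in auto)
  next
    case (Conj A B)
    then show ?case by (simp add: min_def)
  next
    case (Disj A B)
    then show ?case by (simp add: max_def)
  next
    case (Imp A B)
    then obtain a b :: int where a: "eval_fm v A = of_int a / ?K" "0 \<le> a" "a \<le> int (k - 1)"
      and b: "eval_fm v B = of_int b / ?K" "0 \<le> b" "b \<le> int (k - 1)"
      unfolding int by blast
    show ?case
    proof (cases "a \<le> b")
      case True
      then have "eval_fm v A \<le> eval_fm v B" using a b K by (simp add: divide_le_cancel)
      then have "eval_fm v (Imp A B) = of_int (int (k - 1)) / ?K" using K by simp
      then show ?thesis unfolding int using assms(2) by (intro exI[of _ "int (k - 1)"]) simp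
    next
      case False
      then have "eval_fm v B \<le> eval_fm v A" using a b K by (simp add: divide_le_cancel)
      then have "eval_fm v (Imp A B) = 1 - eval_fm v A + eval_fm v B" by simp
      also have "\<dots> = of_int (int (k - 1) - a + b) / ?K"
        using a b K by (simp add: field_simps)
      finally show ?thesis unfolding int using False a b
        by (intro exI[of _ "int (k - 1) - a + b"]) auto
    qed
  qed
qed

text \<open>The ordinary deduction theorem fails for \<open>Imp\<close>; iterating it \<open>k - 1\<close> times gives a
  connective that behaves classically with respect to being designated.\<close>

definition iter_imp :: "nat \<Rightarrow> formula \<Rightarrow> formula \<Rightarrow> formula" where
  "iter_imp k A B = (Imp A ^^ (k - 1)) B"

lemma subst_iter_imp: "subst \<sigma> (iter_imp k A B) = iter_imp k (subst \<sigma> A) (subst \<sigma> B)"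
proof -
  have "subst \<sigma> ((Imp A ^^ n) B) = (Imp (subst \<sigma> A) ^^ n) (subst \<sigma> B)" for n
    by (induction n) auto
  then show ?thesis by (simp add: iter_imp_def)
qed

text \<open>After \<open>n\<close> iterations the value is \<open>min 1 (n * (1 - a) + b)\<close>.
  If \<open>a < 1\<close>, then \<open>k - 1\<close> gaps of at least \<open>1 / (k - 1)\<close> add
  up to 1.\<close>

lemma eval_iter_imp:
  assumes "valuation k v" "k \<ge> 2"
  shows "eval_fm v (iter_imp k A B) = 1 \<longleftrightarrow> (eval_fm v A = 1 \<longrightarrow> eval_fm v B = 1)"
proof -
  let ?a = "eval_fm v A" and ?b = "eval_fm v B"
  note A = eval_fm_in_truth_values[OF assms, of A] and B = eval_fm_in_truth_values[OF assms, of B]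
  have iter: "eval_fm v ((Imp A ^^ n) B) = min 1 (real n * (1 - ?a) + ?b)" for n
  proof (induction n)
    case 0
    then show ?case using truth_values_unit[OF B] by simp
  next
    case (Suc n)
    have "0 \<le> 1 - ?a" using truth_values_unit[OF A] by simp
    then show ?case using Suc by (simp add: algebra_simps min_def)
  qed
  show ?thesis
  proof (cases "?a = 1")
    case True
    then show ?thesis using truth_values_unit[OF B] by (simp add: iter_imp_def iter)
  next
    case False
    then have "1 \<le> real (k - 1) * (1 - ?a)"
      using truth_values_unit[OF A] by (intro truth_values_less_1[OF A _ assms(2)]) simp
    then have "min 1 (real (k - 1) * (1 - ?a) + ?b) = 1"
      using truth_values_unit[OF B] by (intro min_absorb1) linarith
    then show ?thesis unfolding iter_imp_def iter using False by blast
  qed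
qed

lemma eval_Conj_eq_1:
  assumes "valuation k v" "k \<ge> 2"
  shows "eval_fm v (Conj A B) = 1 \<longleftrightarrow> eval_fm v A = 1 \<and> eval_fm v B = 1"
  using truth_values_unit[OF eval_fm_in_truth_values[OF assms, of A]]
    truth_values_unit[OF eval_fm_in_truth_values[OF assms, of B]] by (auto simp: min_def)

lemma eval_Disj_eq_1:
  assumes "valuation k v" "k \<ge> 2"
  shows "eval_fm v (Disj A B) = 1 \<longleftrightarrow> eval_fm v A = 1 \<or> eval_fm v B = 1"
  using truth_values_unit[OF eval_fm_in_truth_values[OF assms, of A]]
    truth_values_unit[OF eval_fm_in_truth_values[OF assms, of B]] by (auto simp: max_def)

lemma eval_Imp_mp:
  assumes "valuation k v" "k \<ge> 2" "eval_fm v (Imp A B) = 1" "eval_fm v A = 1"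
  shows "eval_fm v B = 1"
  using assms(3,4) truth_values_unit[OF eval_fm_in_truth_values[OF assms(1,2), of B]] by simp

section \<open>Frege proofs as counted rule applications\<close>

definition frege_rule :: "formula set \<Rightarrow> formula set \<Rightarrow> formula \<Rightarrow> bool" where
  "frege_rule Ax S A \<longleftrightarrow> A \<in> axiom_instances Ax \<or> (\<exists>B\<in>S. Imp B A \<in> S)"

lemma mono_frege_rule: "mono (frege_rule Ax)"
  unfolding mono_def le_fun_def frege_rule_def by auto

lemma reach_frege_prefix:
  assumes "\<And>i. i < length \<pi> \<Longrightarrow> \<pi> ! i \<in> axiom_instances Ax \<or> \<pi> ! i \<in> S \<or>
        (\<exists>j<i. \<exists>l<i. \<pi> ! l = Imp (\<pi> ! j) (\<pi> ! i))"
  shows "n \<le> length \<pi> \<Longrightarrow> reach (frege_rule Ax) n S (set (take n \<pi>))"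
proof (induction n)
  case 0
  then show ?case by (simp add: reach_refl)
next
  case (Suc n)
  let ?U = "S \<union> set (take n \<pi>)"
  have n: "n < length \<pi>" using Suc.prems by simp
  have "reach (frege_rule Ax) 1 ?U {\<pi> ! n}"
  proof -
    consider "\<pi> ! n \<in> axiom_instances Ax" | "\<pi> ! n \<in> S"
      | j l where "j < n" "l < n" "\<pi> ! l = Imp (\<pi> ! j) (\<pi> ! n)"
      using assms[OF n] by blast
    then show ?thesis
    proof cases
      case 1
      then show ?thesis by (intro reach_step) (simp add: frege_rule_def)
    next
      case 2
      then show ?thesis by (intro reach_refl) simp
    next
      case 3
      have "\<pi> ! j \<in> ?U" "\<pi> ! l \<in> ?U" using 3(1,2) n by (auto simp: in_set_conv_nth)
      then show ?thesis using 3(3) by (intro reach_step) (auto simp: frege_rule_def)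
    qed
  qed
  from reach_trans[OF Suc.IH this mono_frege_rule] Suc.prems
  have "reach (frege_rule Ax) (n + 1) S (?U \<union> {\<pi> ! n})" by simp
  then show ?case
    by (rule reach_weaken[OF _ mono_frege_rule]) (use n in \<open>auto simp: take_Suc_conv_app_nth\<close>)
qed

lemma steps_frege_list:
  assumes "steps (frege_rule Ax) n {} U"
  shows "\<exists>\<pi>. length \<pi> = n \<and> set \<pi> = U \<and> (\<forall>i < length \<pi>. \<pi> ! i \<in> axiom_instances Ax \<or>
        (\<exists>j < i. \<exists>l < i. \<pi> ! l = Imp (\<pi> ! j) (\<pi> ! i)))"
  using assms
proof (induction n "{} :: formula set" U)
  case steps_0
  then show ?case by simp
next
  case (steps_Suc n T a)
  then obtain \<pi> where \<pi>: "length \<pi> = n" "set \<pi> = T"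
    "\<And>i. i < length \<pi> \<Longrightarrow> \<pi> ! i \<in> axiom_instances Ax \<or>
        (\<exists>j < i. \<exists>l < i. \<pi> ! l = Imp (\<pi> ! j) (\<pi> ! i))" by blast
  have "(\<pi> @ [a]) ! i \<in> axiom_instances Ax \<or>
        (\<exists>j < i. \<exists>l < i. (\<pi> @ [a]) ! l = Imp ((\<pi> @ [a]) ! j) ((\<pi> @ [a]) ! i))"
    if i: "i < length (\<pi> @ [a])" for i
  proof (cases "i < length \<pi>")
    case True
    then have "(\<pi> @ [a]) ! p = \<pi> ! p" if "p \<le> i" for p using that by (simp add: nth_append)
    then show ?thesis using \<pi>(3)[OF True] less_imp_le by (metis order_refl)
  next
    case False
    with i have i: "i = length \<pi>" by simp
    show ?thesis
    proof (cases "a \<in> axiom_instances Ax")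
      case False
      then obtain B where "B \<in> set \<pi>" "Imp B a \<in> set \<pi>"
        using steps_Suc.hyps \<pi>(2) unfolding frege_rule_def by blast
      then obtain j l where "j < length \<pi>" "\<pi> ! j = B" "l < length \<pi>" "\<pi> ! l = Imp B a"
        by (auto simp: in_set_conv_nth)
      then have "(\<pi> @ [a]) ! l = Imp ((\<pi> @ [a]) ! j) ((\<pi> @ [a]) ! i)"
        using i by (simp add: nth_append)
      then show ?thesis using i \<open>j < length \<pi>\<close> \<open>l < length \<pi>\<close> by blast
    qed (simp add: i)
  qed
  then show ?case using \<pi>(1,2) by (intro exI[of _ "\<pi> @ [a]"]) auto
qed

lemma frege_proof_of_reach:
  assumes "reach (frege_rule Ax) n {} {A}"
  shows "\<exists>\<pi>. frege_proof Ax {} \<pi> A \<and> length \<pi> \<le> n"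
proof -
  obtain m U where m: "m \<le> n" "steps (frege_rule Ax) m {} U" "A \<in> U"
    using assms by (auto simp: reach_def)
  from steps_frege_list[OF m(2)] obtain \<pi> where \<pi>: "length \<pi> = m" "set \<pi> = U"
    "\<And>i. i < length \<pi> \<Longrightarrow> \<pi> ! i \<in> axiom_instances Ax \<or>
        (\<exists>j < i. \<exists>l < i. \<pi> ! l = Imp (\<pi> ! j) (\<pi> ! i))" by blast
  \<comment> \<open>A Frege proof ends with its conclusion, so the list is cut after an occurrence
    of \<open>A\<close>.\<close>
  obtain p where p: "p < length \<pi>" "\<pi> ! p = A" using m(3) \<pi>(2) by (auto simp: in_set_conv_nth)
  have "frege_proof Ax {} (take (Suc p) \<pi>) A"
    unfolding frege_proof_def
  proof (intro conjI allI impI)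
    show "take (Suc p) \<pi> \<noteq> []" using p by auto
    show "last (take (Suc p) \<pi>) = A" using p by (simp add: take_Suc_conv_app_nth)
    fix i assume i: "i < length (take (Suc p) \<pi>)"
    then have i': "i < length \<pi>" "i < Suc p" by auto
    from \<pi>(3)[OF i'(1)] show "take (Suc p) \<pi> ! i \<in> axiom_instances Ax \<or> take (Suc p) \<pi> ! i \<in> {} \<or>
      (\<exists>j<i. \<exists>l<i. take (Suc p) \<pi> ! l = Imp (take (Suc p) \<pi> ! j) (take (Suc p) \<pi> ! i))"
      using i'(2) by (auto simp: less_trans)
  qed
  moreover have "length (take (Suc p) \<pi>) \<le> n" using m(1) \<pi>(1) by simp
  ultimately show ?thesis by blast
qed

lemma subst_subst: "subst \<sigma> (subst \<tau> A) = subst (subst \<sigma> \<circ> \<tau>) A"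
  by (induction A) auto

lemma axiom_instances_subst: "A \<in> axiom_instances Ax \<Longrightarrow> subst \<sigma> A \<in> axiom_instances Ax"
  unfolding axiom_instances_def using subst_subst by blast

text \<open>Implicational completeness gives one derivation in which variables act as metavariables,
  and its substitution instances have the same length. Hence \<open>c\<close> is uniform in
  \<open>\<sigma>\<close>.\<close>

lemma derived_rule:
  assumes "frege_system k Ax" "finite \<Gamma>" "entails k \<Gamma> A"
  shows "\<exists>c. \<forall>\<sigma>. reach (frege_rule Ax) c (subst \<sigma> ` \<Gamma>) {subst \<sigma> A}"
proof -
  obtain \<pi> where "frege_proof Ax \<Gamma> \<pi> A"
    using assms unfolding frege_system_def implicationally_complete_def by blast
  then have \<pi>: "\<pi> \<noteq> []" "last \<pi> = A"
    "\<And>i. i < length \<pi> \<Longrightarrow> \<pi> ! i \<in> axiom_instances Ax \<or> \<pi> ! i \<in> \<Gamma> \<or>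
        (\<exists>j < i. \<exists>l < i. \<pi> ! l = Imp (\<pi> ! j) (\<pi> ! i))"
    unfolding frege_proof_def by auto
  have "reach (frege_rule Ax) (length \<pi>) (subst \<sigma> ` \<Gamma>) {subst \<sigma> A}" for \<sigma>
  proof -
    let ?\<pi> = "map (subst \<sigma>) \<pi>"
    have "?\<pi> ! i \<in> axiom_instances Ax \<or> ?\<pi> ! i \<in> subst \<sigma> ` \<Gamma> \<or>
        (\<exists>j<i. \<exists>l<i. ?\<pi> ! l = Imp (?\<pi> ! j) (?\<pi> ! i))" if "i < length ?\<pi>" for i
    proof -
      have i: "i < length \<pi>" using that by simp
      consider "\<pi> ! i \<in> axiom_instances Ax" | "\<pi> ! i \<in> \<Gamma>"
        | j l where "j < i" "l < i" "\<pi> ! l = Imp (\<pi> ! j) (\<pi> ! i)"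
        using \<pi>(3)[OF i] by blast
      then show ?thesis
      proof cases
        case 1
        then show ?thesis using i axiom_instances_subst by simp
      next
        case 2
        then show ?thesis using i by simp
      next
        case 3
        then have "?\<pi> ! l = Imp (?\<pi> ! j) (?\<pi> ! i)" using i by simp
        then show ?thesis using 3 by blast
      qed
    qed
    from reach_frege_prefix[of ?\<pi>, OF this, of "length ?\<pi>"]
    have "reach (frege_rule Ax) (length \<pi>) (subst \<sigma> ` \<Gamma>) (set ?\<pi>)" by simp
    moreover have "subst \<sigma> A \<in> set ?\<pi>" using \<pi>(1,2) last_in_set by fastforce
    ultimately show ?thesis by (auto elim: reach_weaken[OF _ mono_frege_rule])
  qed
  then show ?thesis by blast
qed

section \<open>Simulation of nested proofs\<close>

text \<open>The rules of the simulation, with one bound \<open>c\<close> for all and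
  \<open>imp\<close> left abstract. With \<open>X\<close> standing for a context,
  \<open>Conj X C\<close> is its extension by \<open>C\<close>, and
  \<open>Imp (Var 0) (Var 0)\<close> is the empty context.\<close>

locale context_rules =
  fixes Ax :: "formula set" and imp :: "formula \<Rightarrow> formula \<Rightarrow> formula" and c :: nat
  assumes imp_left: "reach (frege_rule Ax) c {} {imp (Conj X Y) X}"
    and imp_right: "reach (frege_rule Ax) c {} {imp (Conj X Y) Y}"
    and imp_trans: "reach (frege_rule Ax) c {imp X Y, imp Y Z} {imp X Z}"
    and imp_const: "reach (frege_rule Ax) c {A} {imp X A}"
    and imp_mp: "reach (frege_rule Ax) c {imp X B, imp X (Imp B A)} {imp X A}"
    and imp_cases: "reach (frege_rule Ax) c
      {imp (Conj X C) E, imp (Conj X D) E, imp X (Disj C D)} {imp X E}"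
    and imp_discharge: "reach (frege_rule Ax) c {imp (Imp (Var 0) (Var 0)) A} {A}"

text \<open>By \<open>eval_iter_imp\<close> each rule is an entailment by reasoning about which
  formulas have value 1; \<open>derived_rule\<close> then gives a derivation schema.\<close>

lemma context_rules_exist:
  assumes k: "k \<ge> 2" and Ax: "frege_system k Ax"
  shows "\<exists>c. context_rules Ax (iter_imp k) c"
proof -
  let ?i = "iter_imp k"
  let ?R = "frege_rule Ax"
  note eqs = eval_iter_imp[OF _ k] eval_Conj_eq_1[OF _ k] eval_Disj_eq_1[OF _ k]
  have "entails k {} (?i (Conj (Var 0) (Var 1)) (Var 0))"
    unfolding entails_def by (auto simp: eqs simp del: eval_fm.simps)
  from derived_rule[OF Ax _ this] obtain c1 where
    c1: "\<And>\<sigma>. reach ?R c1 {} {subst \<sigma> (?i (Conj (Var 0) (Var 1)) (Var 0))}" by auto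
  have "entails k {} (?i (Conj (Var 0) (Var 1)) (Var 1))"
    unfolding entails_def by (auto simp: eqs simp del: eval_fm.simps)
  from derived_rule[OF Ax _ this] obtain c2 where
    c2: "\<And>\<sigma>. reach ?R c2 {} {subst \<sigma> (?i (Conj (Var 0) (Var 1)) (Var 1))}" by auto
  have "entails k {?i (Var 0) (Var 1), ?i (Var 1) (Var 2)} (?i (Var 0) (Var 2))"
    unfolding entails_def by (auto simp: eqs simp del: eval_fm.simps)
  from derived_rule[OF Ax _ this] obtain c3 where
    c3: "\<And>\<sigma>. reach ?R c3 (subst \<sigma> ` {?i (Var 0) (Var 1), ?i (Var 1) (Var 2)})
      {subst \<sigma> (?i (Var 0) (Var 2))}" by auto
  have "entails k {Var 1} (?i (Var 0) (Var 1))"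
    unfolding entails_def by (auto simp: eqs simp del: eval_fm.simps)
  from derived_rule[OF Ax _ this] obtain c4 where
    c4: "\<And>\<sigma>. reach ?R c4 (subst \<sigma> ` {Var 1}) {subst \<sigma> (?i (Var 0) (Var 1))}" by auto
  have "entails k {?i (Var 0) (Var 1), ?i (Var 0) (Imp (Var 1) (Var 2))} (?i (Var 0) (Var 2))"
    unfolding entails_def by (auto simp: eqs simp del: eval_fm.simps intro: eval_Imp_mp[OF _ k])
  from derived_rule[OF Ax _ this] obtain c5 where
    c5: "\<And>\<sigma>. reach ?R c5 (subst \<sigma> ` {?i (Var 0) (Var 1), ?i (Var 0) (Imp (Var 1) (Var 2))})
      {subst \<sigma> (?i (Var 0) (Var 2))}" by auto
  have "entails k {?i (Conj (Var 0) (Var 1)) (Var 3), ?i (Conj (Var 0) (Var 2)) (Var 3),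
      ?i (Var 0) (Disj (Var 1) (Var 2))} (?i (Var 0) (Var 3))"
    unfolding entails_def by (auto simp: eqs simp del: eval_fm.simps)
  from derived_rule[OF Ax _ this] obtain c6 where
    c6: "\<And>\<sigma>. reach ?R c6 (subst \<sigma> ` {?i (Conj (Var 0) (Var 1)) (Var 3),
      ?i (Conj (Var 0) (Var 2)) (Var 3), ?i (Var 0) (Disj (Var 1) (Var 2))})
      {subst \<sigma> (?i (Var 0) (Var 3))}" by auto
  have "entails k {?i (Imp (Var 0) (Var 0)) (Var 1)} (Var 1)"
    unfolding entails_def by (auto simp: eqs)
  from derived_rule[OF Ax _ this] obtain c7 where
    c7: "\<And>\<sigma>. reach ?R c7 (subst \<sigma> ` {?i (Imp (Var 0) (Var 0)) (Var 1)}) {subst \<sigma> (Var 1)}" by auto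
  define c where "c = c1 + c2 + c3 + c4 + c5 + c6 + c7"
  note w = reach_weaken[OF _ mono_frege_rule _ order_refl order_refl, of _ _ _ _ c]
  have "context_rules Ax ?i c"
  proof
    fix X Y Z A B C D E
    \<comment> \<open>The list is read as a substitution: \<open>Var n\<close> becomes its entry
      \<open>n\<close>.\<close>
    show "reach ?R c {} {?i (Conj X Y) X}"
      by (rule w[of _ c1]) (use c1[of "(!) [X, Y]"] in \<open>auto simp: subst_iter_imp c_def\<close>)
    show "reach ?R c {} {?i (Conj X Y) Y}"
      by (rule w[of _ c2]) (use c2[of "(!) [X, Y]"] in \<open>auto simp: subst_iter_imp c_def\<close>)
    show "reach ?R c {?i X Y, ?i Y Z} {?i X Z}"
      by (rule w[of _ c3]) (use c3[of "(!) [X, Y, Z]"] in \<open>auto simp: subst_iter_imp c_def\<close>)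
    show "reach ?R c {A} {?i X A}"
      by (rule w[of _ c4]) (use c4[of "(!) [X, A]"] in \<open>auto simp: subst_iter_imp c_def\<close>)
    show "reach ?R c {?i X B, ?i X (Imp B A)} {?i X A}"
      by (rule w[of _ c5]) (use c5[of "(!) [X, B, A]"] in \<open>auto simp: subst_iter_imp c_def\<close>)
    show "reach ?R c {?i (Conj X C) E, ?i (Conj X D) E, ?i X (Disj C D)} {?i X E}"
      by (rule w[of _ c6]) (use c6[of "(!) [X, C, D, E]"] in \<open>auto simp: subst_iter_imp c_def\<close>)
    show "reach ?R c {?i (Imp (Var 0) (Var 0)) A} {A}"
      by (rule w[of _ c7]) (use c7[of "(!) [Var 0, A]"] in \<open>auto simp: subst_iter_imp c_def\<close>)
  qed
  then show ?thesis by blast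
qed

section \<open>Premises and contexts in nested proofs\<close>

text \<open>Records where the premises of a line occur and how their contexts relate, which is what
  an induction over the translated lines reads off.\<close>

inductive valid_lines :: "formula set \<Rightarrow> line list \<Rightarrow> bool" for Ax where
  valid_Nil: "valid_lines Ax []"
| valid_axiom: "valid_lines Ax Q \<Longrightarrow> A \<in> axiom_instances Ax \<Longrightarrow> valid_lines Ax (Q @ [(\<Gamma>, A)])"
| valid_assumption: "valid_lines Ax Q \<Longrightarrow> valid_lines Ax (Q @ [(\<Gamma> @ [C], C)])"
| valid_mp: "valid_lines Ax Q \<Longrightarrow> (\<Gamma>\<^sub>1, B) \<in> set Q \<Longrightarrow> prefix \<Gamma>\<^sub>1 \<Gamma> \<Longrightarrow>
    (\<Gamma>\<^sub>2, Imp B A) \<in> set Q \<Longrightarrow> prefix \<Gamma>\<^sub>2 \<Gamma> \<Longrightarrow> valid_lines Ax (Q @ [(\<Gamma>, A)])"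
| valid_cases: "valid_lines Ax Q \<Longrightarrow> (\<Gamma> @ [C], E) \<in> set Q \<Longrightarrow> (\<Gamma> @ [D], E) \<in> set Q \<Longrightarrow>
    (\<Gamma>\<^sub>1, Disj C D) \<in> set Q \<Longrightarrow> prefix \<Gamma>\<^sub>1 \<Gamma> \<Longrightarrow> valid_lines Ax (Q @ [(\<Gamma>, E)])"

lemma availableE:
  assumes "available P X \<Gamma> A"
  obtains \<Delta> where "(\<Delta>, A) \<in> set P" "prefix \<Delta> \<Gamma>"
proof -
  from assms obtain i where i: "i < length P" "prefix (fst (P ! i)) \<Gamma>" "snd (P ! i) = A"
    unfolding available_def by blast
  then have "(fst (P ! i), A) \<in> set P" using nth_mem[OF i(1)] by (metis prod.collapse)
  then show ?thesis using that i(2) by blast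
qed

lemma nested_extends:
  "nested Ax \<Gamma> P X Q Y m \<Longrightarrow> prefix P Q \<and> (Q = P \<or> fst (last Q) = \<Gamma>)"
  by (induction rule: nested.induct) (auto simp: prefix_def)

lemma nested_block_last:
  assumes "nested Ax \<Gamma> (P @ [(\<Gamma>, C)]) X Q Y m"
  shows "(\<Gamma>, snd (last Q)) \<in> set Q"
proof -
  have "prefix (P @ [(\<Gamma>, C)]) Q" "fst (last Q) = \<Gamma>"
    using nested_extends[OF assms] by auto
  moreover from this have "last Q \<in> set Q" by (intro last_in_set) auto
  ultimately show ?thesis by (metis prod.collapse)
qed

lemma nested_valid_lines: "nested Ax \<Gamma> P X Q Y m \<Longrightarrow> valid_lines Ax P \<Longrightarrow> valid_lines Ax Q"
proof (induction rule: nested.induct)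
  case (modus_ponens \<Gamma> P X Q Y m B A)
  then show ?case by (elim availableE) (rule valid_mp)
next
  case (or_elim \<Gamma> P X P\<^sub>0 X\<^sub>0 m\<^sub>0 C P\<^sub>1 X\<^sub>1 m\<^sub>1 E P\<^sub>2 X\<^sub>2 m\<^sub>2 D P\<^sub>3 X\<^sub>3 m\<^sub>3 P\<^sub>4 X\<^sub>4 m\<^sub>4)
  have v: "valid_lines Ax P\<^sub>4" using or_elim by (simp add: valid_assumption)
  have "prefix P\<^sub>1 P\<^sub>2" "prefix (P\<^sub>2 @ [(\<Gamma> @ [D], D)]) P\<^sub>3" "prefix P\<^sub>3 P\<^sub>4"
    using nested_extends or_elim.hyps by blast+
  then have sub: "set P\<^sub>1 \<subseteq> set P\<^sub>4" "set P\<^sub>3 \<subseteq> set P\<^sub>4" by (auto simp: prefix_def)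
  have "(\<Gamma> @ [C], E) \<in> set P\<^sub>1" using nested_block_last[OF or_elim.hyps(2)] or_elim.hyps(3) by simp
  moreover have "(\<Gamma> @ [D], E) \<in> set P\<^sub>3"
    using nested_block_last[OF or_elim.hyps(5)] or_elim.hyps(6) by simp
  moreover obtain \<Delta> where "(\<Delta>, Disj C D) \<in> set P\<^sub>4" "prefix \<Delta> \<Gamma>"
    using or_elim.hyps(8) by (rule availableE)
  ultimately show ?case using v sub by (intro valid_cases[of Ax P\<^sub>4 \<Gamma> C E D \<Delta>]) auto
qed (auto intro: valid_axiom)

text \<open>The empty context is included so that the root is present before the first line is
  written.\<close>

definition contexts :: "line list \<Rightarrow> formula list set" where
  "contexts P = insert [] (fst ` set P)"

lemma contexts_snoc [simp]: "contexts (P @ [(\<Gamma>, A)]) = insert \<Gamma> (contexts P)"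
  by (auto simp: contexts_def)

lemma take_closed_snoc:
  assumes "\<forall>u\<in>T. \<forall>d. take d u \<in> T" "u \<in> T"
  shows "\<forall>v\<in>insert (u @ [x]) T. \<forall>d. take d v \<in> insert (u @ [x]) T"
proof (intro ballI allI)
  fix v d assume "v \<in> insert (u @ [x]) T"
  then show "take d v \<in> insert (u @ [x]) T"
    using assms by (cases "d \<le> length u") auto
qed

text \<open>Opening an assumption appends one formula to a context already present, so the contexts
  form a tree in which \<open>take\<close> gives the ancestors.\<close>

lemma nested_contexts:
  assumes "nested Ax \<Gamma> P X Q Y m" "\<forall>u\<in>contexts P. \<forall>d. take d u \<in> contexts P" "\<Gamma> \<in> contexts P"
  shows "(\<forall>u\<in>contexts Q. \<forall>d. take d u \<in> contexts Q) \<and> contexts P \<subseteq> contexts Q"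
  using assms
proof (induction rule: nested.induct)
  case (or_elim \<Gamma> P X P\<^sub>0 X\<^sub>0 m\<^sub>0 C P\<^sub>1 X\<^sub>1 m\<^sub>1 E P\<^sub>2 X\<^sub>2 m\<^sub>2 D P\<^sub>3 X\<^sub>3 m\<^sub>3 P\<^sub>4 X\<^sub>4 m\<^sub>4)
  let ?cl = "\<lambda>T :: formula list set. \<forall>u\<in>T. \<forall>d. take d u \<in> T"
  have 0: "?cl (contexts P\<^sub>0)" "contexts P \<subseteq> contexts P\<^sub>0" "\<Gamma> \<in> contexts P\<^sub>0"
    using or_elim.IH(1) or_elim.prems by auto
  have 1: "?cl (contexts P\<^sub>1)" "contexts P\<^sub>0 \<subseteq> contexts P\<^sub>1"
    using or_elim.IH(2) take_closed_snoc[OF 0(1,3), of C] by auto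
  have 2: "?cl (contexts P\<^sub>2)" "contexts P\<^sub>1 \<subseteq> contexts P\<^sub>2" "\<Gamma> \<in> contexts P\<^sub>2"
    using or_elim.IH(3) 0(3) 1 by (simp_all add: subset_iff)
  have 3: "?cl (contexts P\<^sub>3)" "contexts P\<^sub>2 \<subseteq> contexts P\<^sub>3"
    using or_elim.IH(4) take_closed_snoc[OF 2(1,3), of D] by auto
  have 4: "?cl (contexts P\<^sub>4)" "contexts P\<^sub>3 \<subseteq> contexts P\<^sub>4" "\<Gamma> \<in> contexts P\<^sub>4"
    using or_elim.IH(5) 2(3) 3 by (simp_all add: subset_iff)
  have "contexts (P\<^sub>4 @ [(\<Gamma>, E)]) = contexts P\<^sub>4" using 4 by auto
  then show ?case using 0 1 2 3 4 by simp
qed (auto simp: insert_absorb subsetD)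

lemma nested_context_length:
  assumes "nested Ax \<Gamma> P X Q Y m"
  shows "u \<in> contexts Q \<Longrightarrow> u \<in> contexts P \<or> length u \<le> length \<Gamma> + m"
  using assms
proof (induction arbitrary: u rule: nested.induct)
  case (or_elim \<Gamma> P X P\<^sub>0 X\<^sub>0 m\<^sub>0 C P\<^sub>1 X\<^sub>1 m\<^sub>1 E P\<^sub>2 X\<^sub>2 m\<^sub>2 D P\<^sub>3 X\<^sub>3 m\<^sub>3 P\<^sub>4 X\<^sub>4 m\<^sub>4)
  show ?case
  proof (rule ccontr)
    \<comment> \<open>A context exceeding the bound is traced back through all stages to the lines
      \<open>P\<close>.\<close>
    assume "\<not> ?case"
    then have n: "u \<notin> contexts P" "length u > length \<Gamma> + (m\<^sub>0 + m\<^sub>1 + m\<^sub>2 + m\<^sub>3 + m\<^sub>4 + 2)" by auto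
    then have "u \<in> contexts P\<^sub>4" using or_elim.prems by auto
    then have "u \<in> contexts P\<^sub>3" using or_elim.IH(5)[of u] n by auto
    then have "u \<in> contexts P\<^sub>2" using or_elim.IH(4)[of u] n by auto
    then have "u \<in> contexts P\<^sub>1" using or_elim.IH(3)[of u] n by auto
    then have "u \<in> contexts P\<^sub>0" using or_elim.IH(2)[of u] n by auto
    then show False using or_elim.IH(1)[of u] n by auto
  qed
qed auto

text \<open>Assumptions are opened in pairs, which excludes \<open>m = 1\<close>.\<close>

lemma nested_even: "nested Ax \<Gamma> P X Q Y m \<Longrightarrow> even m"
  by (induction rule: nested.induct) auto

lemma nested_proof_facts:
  assumes "nested_proof Ax P m A"
  shows "valid_lines Ax P" "P \<noteq> []" "([], A) \<in> set P" "even m"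
    and "u \<in> fst ` set P \<Longrightarrow> take d u \<in> fst ` set P" "u \<in> fst ` set P \<Longrightarrow> length u \<le> m"
proof -
  obtain X where X: "nested Ax [] [] {} P X m" and P: "P \<noteq> []" "last P = ([], A)"
    using assms unfolding nested_proof_def by blast
  show "P \<noteq> []" by (rule P)
  show A: "([], A) \<in> set P" using P last_in_set by metis
  show "valid_lines Ax P" using nested_valid_lines[OF X valid_Nil] .
  show "even m" using nested_even[OF X] .
  \<comment> \<open>The last line has the empty context, so the root is among the contexts of
    lines.\<close>
  have c: "contexts P = fst ` set P" using A by (force simp: contexts_def)
  show "u \<in> fst ` set P \<Longrightarrow> take d u \<in> fst ` set P"
    using nested_contexts[OF X] unfolding c[symmetric]
    by (metis (no_types) contexts_def empty_set image_is_empty insertI1 singletonD take_Nil)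
  show "u \<in> fst ` set P \<Longrightarrow> length u \<le> m"
    using nested_context_length[OF X, of u] unfolding c[symmetric] by (auto simp: contexts_def)
qed

section \<open>Translation of lines and edges to implications\<close>

text \<open>Folding from the left makes the newest assumption the outer conjunct, so a context is
  one \<open>Conj\<close> away from its parent. A tautology represents the empty context.\<close>

definition conj_context :: "formula list \<Rightarrow> formula" where
  "conj_context \<Gamma> = foldl Conj (Imp (Var 0) (Var 0)) \<Gamma>"

lemma conj_context_snoc: "conj_context (\<Gamma> @ [C]) = Conj (conj_context \<Gamma>) C"
  by (simp add: conj_context_def)

context context_rules
begin

definition edge_formula :: "formula list \<times> formula list \<Rightarrow> formula" where
  "edge_formula = (\<lambda>(u, v). imp (conj_context u) (conj_context v))"

definition line_formula :: "line \<Rightarrow> formula" where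
  "line_formula = (\<lambda>(\<Gamma>, A). imp (conj_context \<Gamma>) A)"

abbreviation "derives \<equiv> reach (frege_rule Ax)"

lemmas derives_weaken = reach_weaken[OF _ mono_frege_rule]
lemmas derives_trans = reach_trans[OF _ _ mono_frege_rule]

lemma derives_cut:
  assumes "derives n S T" "derives m T U" shows "derives (n + m) S U"
proof -
  have "derives m (S \<union> T) U" by (rule derives_weaken[OF assms(2)]) auto
  from derives_trans[OF assms(1) this] show ?thesis by (rule derives_weaken) auto
qed

lemma edge_formulas_compose:
  assumes "reach compose_rule e S E"
  shows "derives (c * e) (edge_formula ` S) (edge_formula ` E)"
proof (rule reach_transfer[OF assms mono_frege_rule])
  fix T :: "(formula list \<times> formula list) set" and a assume "compose_rule T a"
  then obtain u v w where "(u, v) \<in> T" "(v, w) \<in> T" and a: "a = (u, w)"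
    unfolding compose_rule_def by auto
  then have "{edge_formula (u, v), edge_formula (v, w)} \<subseteq> edge_formula ` T" by auto
  moreover have "derives c {edge_formula (u, v), edge_formula (v, w)} {edge_formula a}"
    using imp_trans by (simp add: edge_formula_def a)
  ultimately show "derives c (edge_formula ` T) {edge_formula a}"
    by (auto intro: derives_weaken)
qed

text \<open>One instance of \<open>imp_left\<close> per context other than the root.\<close>

lemma derive_parent_edges:
  assumes "finite T"
  shows "derives (c * card T) {} (edge_formula ` parent_edges T (\<lambda>q. q) h)"
proof -
  have "derives (\<Sum>u\<in>T. c) {} (\<Union>u\<in>T. if u = [] then {} else {edge_formula (u, butlast u)})"
  proof (rule reach_UN[OF assms mono_frege_rule])
    fix u assume "u \<in> T"
    show "derives c {} (if u = [] then {} else {edge_formula (u, butlast u)})"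
    proof (cases u rule: rev_cases)
      case (snoc v x)
      then show ?thesis using imp_left by (simp add: edge_formula_def conj_context_snoc)
    qed (simp add: reach_refl)
  qed
  then show ?thesis
  proof (rule derives_weaken)
    show "edge_formula ` parent_edges T (\<lambda>q. q) h
      \<subseteq> (\<Union>u\<in>T. if u = [] then {} else {edge_formula (u, butlast u)})"
    proof clarify
      fix u v assume "(u, v) \<in> parent_edges T (\<lambda>q. q) h"
      then have "u \<in> T" "u \<noteq> []" "v = butlast u"
        by (auto simp: parent_edges_def butlast_conv_take)
      then show "edge_formula (u, v) \<in> (\<Union>u\<in>T. if u = [] then {} else {edge_formula (u, butlast u)})"
        by (intro UN_I[of u]) auto
    qed
  qed (simp_all add: mult.commute)
qed

text \<open>An edge is an implication from the longer context to the shorter, so one use of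
  transitivity carries \<open>B\<close> across it.\<close>

lemma lift_along_path:
  assumes "(u, v) \<in> (E\<^sup>=) ^^ f"
  shows "derives (c * f) (insert (line_formula (v, B)) (edge_formula ` E)) {line_formula (u, B)}"
  using assms
proof (induction f arbitrary: u)
  case 0
  then show ?case by (simp add: reach_refl)
next
  case (Suc f)
  let ?S = "insert (line_formula (v, B)) (edge_formula ` E)"
  from Suc.prems obtain w where w: "(u, w) \<in> E\<^sup>=" "(w, v) \<in> (E\<^sup>=) ^^ f"
    by (rule relpow_Suc_E2)
  show ?case
  proof (cases "u = w")
    case True
    then show ?thesis by (intro derives_weaken[OF Suc.IH[OF w(2)]]) auto
  next
    case False
    then have "edge_formula (u, w) \<in> edge_formula ` E" using w(1) by blast
    moreover have "derives c {edge_formula (u, w), line_formula (w, B)} {line_formula (u, B)}"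
      using imp_trans by (simp add: edge_formula_def line_formula_def)
    ultimately have "derives c (?S \<union> {line_formula (w, B)}) {line_formula (u, B)}"
      by (auto intro: derives_weaken)
    from derives_trans[OF Suc.IH[OF w(2)] this] show ?thesis by (rule derives_weaken) auto
  qed
qed

lemma lift_line:
  assumes "\<And>u d. u \<in> T \<Longrightarrow> (u, take d u) \<in> (E\<^sup>=) ^^ f" and "\<Gamma> \<in> T" "prefix \<Delta> \<Gamma>"
    and "(\<Delta>, B) \<in> set Q"
  shows "derives (c * f) (edge_formula ` E \<union> line_formula ` set Q) {line_formula (\<Gamma>, B)}"
proof -
  have "take (length \<Delta>) \<Gamma> = \<Delta>" using assms(3) by (auto simp: prefix_def)
  then have "(\<Gamma>, \<Delta>) \<in> (E\<^sup>=) ^^ f" using assms(1)[OF assms(2), of "length \<Delta>"] by simp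
  from lift_along_path[OF this, of B] show ?thesis
    by (rule derives_weaken) (use assms(4) in auto)
qed

text \<open>Modus ponens is the dearest case: two premises are lifted at \<open>c * f\<close> each
  and the rule costs \<open>c\<close>. The extra 1 pays for an axiom instance.\<close>

lemma simulate_lines:
  assumes "\<And>u d. u \<in> T \<Longrightarrow> (u, take d u) \<in> (E\<^sup>=) ^^ f"
    and "valid_lines Ax Q" "fst ` set Q \<subseteq> T"
  shows "derives (length Q * (c * (2 * f + 1) + 1)) (edge_formula ` E) (line_formula ` set Q)"
  using assms(2,3)
proof induction
  case valid_Nil
  then show ?case by (simp add: reach_refl)
next
  have extend: "derives (length (Q @ [(\<Gamma>, A)]) * (c * (2 * f + 1) + 1)) (edge_formula ` E)
      (line_formula ` set (Q @ [(\<Gamma>, A)]))"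
    if "derives (length Q * (c * (2 * f + 1) + 1)) (edge_formula ` E) (line_formula ` set Q)"
      and "derives (c * (2 * f + 1) + 1) (edge_formula ` E \<union> line_formula ` set Q) {line_formula (\<Gamma>, A)}"
    for Q \<Gamma> A
    by (rule derives_weaken[OF derives_trans[OF that]]) auto
  note lift = lift_line[where T = T and E = E and f = f, OF assms(1)]
  {
    case (valid_axiom Q A \<Gamma>)
    let ?S = "edge_formula ` E \<union> line_formula ` set Q"
    have "derives 1 ?S {A}" by (rule reach_step) (simp add: frege_rule_def valid_axiom)
    moreover have "derives c {A} {line_formula (\<Gamma>, A)}"
      using imp_const by (simp add: line_formula_def)
    ultimately have "derives (1 + c) ?S {line_formula (\<Gamma>, A)}" by (rule derives_cut)
    then have "derives (c * (2 * f + 1) + 1) ?S {line_formula (\<Gamma>, A)}"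
      by (rule derives_weaken) auto
    then show ?case using valid_axiom by (intro extend) auto
  next
    case (valid_assumption Q \<Gamma> C)
    have "derives c {} {line_formula (\<Gamma> @ [C], C)}"
      using imp_right by (simp add: line_formula_def conj_context_snoc)
    then have "derives (c * (2 * f + 1) + 1) (edge_formula ` E \<union> line_formula ` set Q)
      {line_formula (\<Gamma> @ [C], C)}"
      by (rule derives_weaken) auto
    then show ?case using valid_assumption by (intro extend) auto
  next
    case (valid_mp Q \<Gamma>\<^sub>1 B \<Gamma> \<Gamma>\<^sub>2 A)
    let ?S = "edge_formula ` E \<union> line_formula ` set Q"
    have \<Gamma>: "\<Gamma> \<in> T" using valid_mp.prems by simp
    have "derives (c * f + c * f) ?S ({line_formula (\<Gamma>, B)} \<union> {line_formula (\<Gamma>, Imp B A)})"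
      using valid_mp.hyps \<Gamma> by (intro reach_Un mono_frege_rule lift) auto
    moreover have "derives c ({line_formula (\<Gamma>, B)} \<union> {line_formula (\<Gamma>, Imp B A)}) {line_formula (\<Gamma>, A)}"
      using imp_mp by (simp add: line_formula_def insert_commute)
    ultimately have "derives (c * f + c * f + c) ?S {line_formula (\<Gamma>, A)}" by (rule derives_cut)
    then have "derives (c * (2 * f + 1) + 1) ?S {line_formula (\<Gamma>, A)}"
      by (rule derives_weaken) (auto simp: algebra_simps)
    then show ?case using valid_mp by (intro extend) auto
  next
    case (valid_cases Q \<Gamma> C F D \<Gamma>\<^sub>1)
    let ?S = "edge_formula ` E \<union> line_formula ` set Q"
    let ?U = "{line_formula (\<Gamma> @ [C], F), line_formula (\<Gamma> @ [D], F)}"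
    have \<Gamma>: "\<Gamma> \<in> T" using valid_cases.prems by simp
    \<comment> \<open>The two copies of \<open>F\<close> are already in the contexts that
      \<open>imp_cases\<close> expects; only the disjunction is lifted.\<close>
    have "derives (0 + c * f) ?S (?U \<union> {line_formula (\<Gamma>, Disj C D)})"
      using valid_cases.hyps \<Gamma> by (intro reach_Un[OF reach_refl _ mono_frege_rule] lift) auto
    moreover have "derives c (?U \<union> {line_formula (\<Gamma>, Disj C D)}) {line_formula (\<Gamma>, F)}"
      using imp_cases by (simp add: line_formula_def conj_context_snoc insert_commute)
    ultimately have "derives (0 + c * f + c) ?S {line_formula (\<Gamma>, F)}" by (rule derives_cut)
    then have "derives (c * (2 * f + 1) + 1) ?S {line_formula (\<Gamma>, F)}"
      by (rule derives_weaken) (auto simp: algebra_simps)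
    then show ?case using valid_cases by (intro extend) auto
  }
qed

text \<open>To the \<open>2 * f + 1\<close> of \<open>simulate_lines\<close> come two more
  \<open>c\<close> per line: one for the parent edges, as there are at most as many contexts as
  lines, and one that absorbs the final removal of the empty context.\<close>

lemma frege_simulation:
  assumes P: "nested_proof Ax P m A"
    and E: "reach compose_rule e (parent_edges (fst ` set P) (\<lambda>q. q) h) E"
    and path: "\<And>u d. u \<in> fst ` set P \<Longrightarrow> (u, take d u) \<in> (E\<^sup>=) ^^ f"
  shows "\<exists>\<pi>. frege_proof Ax {} \<pi> A \<and>
    length \<pi> \<le> length P * (c * (2 * f + 3) + 1) + c * e"
proof -
  note facts = nested_proof_facts[OF P]
  let ?T = "fst ` set P"
  let ?n = "length P * (c * (2 * f + 1) + 1)"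
  have "card ?T \<le> length P" by (meson card_image_le card_length finite_set le_trans)
  then have "derives (c * length P) {} (edge_formula ` parent_edges ?T (\<lambda>q. q) h)"
    by (intro derives_weaken[OF derive_parent_edges[of ?T]]) auto
  from derives_cut[OF this edge_formulas_compose[OF E]]
  have "derives (c * length P + c * e) {} (edge_formula ` E)" .
  from derives_cut[OF this simulate_lines[OF path facts(1) order_refl]]
  have "derives (c * length P + c * e + ?n) {} (line_formula ` set P)" .
  moreover have "derives c (line_formula ` set P) {A}"
  proof (rule derives_weaken)
    show "derives c {line_formula ([], A)} {A}"
      using imp_discharge by (simp add: line_formula_def conj_context_def)
  qed (use facts(3) in auto)
  ultimately have "derives (c * length P + c * e + ?n + c) {} {A}" by (rule derives_cut)
  from frege_proof_of_reach[OF this] obtain \<pi> where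
    \<pi>: "frege_proof Ax {} \<pi> A" "length \<pi> \<le> c * length P + c * e + ?n + c" by blast
  have "c \<le> c * length P" using facts(2) by (cases P) auto
  then have "length \<pi> \<le> c * length P + c * e + ?n + c * length P" using \<pi>(2) by linarith
  also have "\<dots> = length P * (c * (2 * f + 3) + 1) + c * e" by (simp add: algebra_simps)
  finally have "length \<pi> \<le> length P * (c * (2 * f + 3) + 1) + c * e" .
  then show ?thesis using \<pi>(1) by blast
qed

end

section \<open>The two bounds\<close>

lemma inverse_ackermann_bounds:
  "1 \<le> inverse_ackermann n" "n \<le> ackermann (inverse_ackermann n) (inverse_ackermann n)"
proof -
  have "1 \<le> Suc n \<and> n \<le> ackermann (Suc n) (Suc n)" using ackermann_gt[of "Suc n" "Suc n"] by simp
  then have "1 \<le> inverse_ackermann n \<and> n \<le> ackermann (inverse_ackermann n) (inverse_ackermann n)"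
    unfolding inverse_ackermann_def by (rule LeastI)
  then show "1 \<le> inverse_ackermann n" "n \<le> ackermann (inverse_ackermann n) (inverse_ackermann n)"
    by auto
qed

text \<open>As long as the argument exceeds 1, each application lowers its integer bound by
  1.\<close>

lemma iterate_reaches_1:
  fixes f :: "real \<Rightarrow> real"
  assumes "\<And>p y. 1 < y \<Longrightarrow> y \<le> real (Suc p) \<Longrightarrow> f y \<le> real p"
  shows "x \<le> real (Suc p) \<Longrightarrow> \<exists>j\<le>p. (f ^^ j) x \<le> 1"
proof (induction p arbitrary: x)
  case 0
  then show ?case by simp
next
  case (Suc p)
  show ?case
  proof (cases "x \<le> 1")
    case True
    then show ?thesis by (intro exI[of _ 0]) simp
  next
    case False
    then have "f x \<le> real (Suc p)" using Suc.prems by (intro assms) auto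
    from Suc.IH[OF this] obtain j where "j \<le> p" "(f ^^ j) (f x) \<le> 1" by blast
    then show ?thesis by (intro exI[of _ "Suc j"]) (simp add: funpow_swap1)
  qed
qed

text \<open>Ensures that the iterations in \<open>log_star\<close> reach 1, so that
  \<open>LEAST\<close> has a witness. For the logarithm it is \<open>p + 1 \<le> 2 ^ p\<close>;
  above it, the function one level lower needs at most \<open>p\<close> iterations.\<close>

lemma log_star_le:
  "1 < y \<Longrightarrow> y \<le> real (Suc p) \<Longrightarrow> log_star i y \<le> real p"
proof (induction i arbitrary: y p)
  case 0
  have "y \<le> real (Suc p)" by (rule 0)
  also have "\<dots> \<le> 2 ^ p" by (induction p) auto
  finally have "log 2 y \<le> log 2 (2 ^ p)" using 0(1) by (intro log_mono) auto
  then show ?case by (simp add: log_nat_power)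
next
  case (Suc i)
  obtain j where "j \<le> p" "(log_star i ^^ j) y \<le> 1"
    using iterate_reaches_1[of "log_star i", OF Suc.IH Suc.prems(2)] by blast
  then have "(LEAST j. (log_star i ^^ j) y \<le> 1) \<le> p" by (meson Least_le le_trans)
  then show ?case by simp
qed

lemma log_star_ge_1:
  assumes "m \<ge> 2"
  shows "1 \<le> log_star i (real m)"
proof (cases i)
  case 0
  then show ?thesis using assms by (simp add: le_log_iff)
next
  case (Suc i')
  obtain j where "(log_star i' ^^ j) (real m) \<le> 1"
    using iterate_reaches_1[of "log_star i'" "real m" m, OF log_star_le] by auto
  then have least: "(log_star i' ^^ (LEAST j. (log_star i' ^^ j) (real m) \<le> 1)) (real m) \<le> 1"
    by (rule LeastI)
  have "(LEAST j. (log_star i' ^^ j) (real m) \<le> 1) \<noteq> 0"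
  proof
    assume "(LEAST j. (log_star i' ^^ j) (real m) \<le> 1) = 0"
    with least show False using assms by simp
  qed
  then show ?thesis using Suc by simp
qed

section \<open>Size, height and parent paths of a tree\<close>

lemma sum_width_le_card:
  assumes "finite T"
  shows "(\<Sum>q<h. width T q) \<le> card T"
proof -
  have "(\<Sum>q<h. width T q) = card (\<Union>q<h. {u \<in> T. length u = q})"
    unfolding width_def using assms by (subst card_UN_disjoint) auto
  also have "\<dots> \<le> card T" using assms by (intro card_mono) auto
  finally show ?thesis .
qed

text \<open>The prefixes of \<open>u\<close> are \<open>length u + 1\<close> distinct nodes.\<close>

lemma length_less_card:
  assumes "finite T" "\<And>u d. u \<in> T \<Longrightarrow> take d u \<in> T" "u \<in> T"
  shows "length u < card T"
proof -
  have "inj_on (\<lambda>d. take d u) {..length u}"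
    by (rule inj_onI) (metis atMost_iff length_take min.absorb2)
  then have "card ((\<lambda>d. take d u) ` {..length u}) = Suc (length u)" by (simp add: card_image)
  moreover have "card ((\<lambda>d. take d u) ` {..length u}) \<le> card T"
    using assms by (intro card_mono image_subsetI)
  ultimately show ?thesis by simp
qed

lemma parent_path:
  assumes "\<And>u d. u \<in> T \<Longrightarrow> take d u \<in> T" "u \<in> T" "length u < h"
  shows "t \<le> length u \<Longrightarrow> (u, take (length u - t) u) \<in> ((parent_edges T (\<lambda>q. q) h)\<^sup>=) ^^ t"
proof (induction t)
  case (Suc t)
  have "(take (Suc (length u - Suc t)) u, take (length u - Suc t) u) \<in> parent_edges T (\<lambda>q. q) h"
    using assms Suc.prems
    by (intro parent_edges_take[where q = "length u"]) (auto simp: strict_mono_def)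
  moreover have "Suc (length u - Suc t) = length u - t" using Suc.prems by simp
  ultimately have "(take (length u - t) u, take (length u - Suc t) u)
      \<in> (parent_edges T (\<lambda>q. q) h)\<^sup>=" by simp
  moreover have "(u, take (length u - t) u) \<in> ((parent_edges T (\<lambda>q. q) h)\<^sup>=) ^^ t"
    using Suc by simp
  ultimately show ?case by (rule relpow_Suc_I[rotated])
qed simp

section \<open>The choice of edges for each bound\<close>

context context_rules
begin

lemma inverse_ackermann_simulation:
  assumes P: "nested_proof Ax P m A"
  shows "\<exists>\<pi>. frege_proof Ax {} \<pi> A \<and>
    length \<pi> \<le> (33 * c + 1) * (length P * inverse_ackermann (length P))"
proof -
  note facts = nested_proof_facts[OF P]
  let ?T = "fst ` set P"
  define n where "n = length P"
  define i where "i = inverse_ackermann n"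
  have T: "finite ?T" "card ?T \<le> n"
    by (auto simp: n_def) (meson card_image_le card_length finite_set le_trans)
  \<comment> \<open>Contexts have fewer than \<open>n\<close> formulas, so \<open>n\<close> levels
    cover their tree.\<close>
  have "n \<le> span_height (Suc i) 4"
    using inverse_ackermann_bounds(2)[of n] ackermann_diagonal_le[of i] by (simp add: i_def)
  then obtain E where
    E: "reach compose_rule ((2 * Suc i + 1) * 4 * (\<Sum>q<n. width ?T q)) (parent_edges ?T (\<lambda>q. q) n) E"
    and E_spans: "spans ?T (\<lambda>q. q) n (2 * Suc i + 1) E"
    using ancestor_shortcuts[OF T(1) facts(5), of "\<lambda>q. q" n "Suc i" 4]
    by (auto simp: strict_mono_def)
  have path: "(u, take d u) \<in> (E\<^sup>=) ^^ (2 * Suc i + 1)" if u: "u \<in> ?T" for u d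
  proof (cases "d < length u")
    case True
    have "length u < n" using length_less_card[OF T(1) facts(5) u] T(2) by simp
    then show ?thesis using True E_spans u unfolding spans_def by blast
  next
    case False
    then have "take d u = u" by simp
    then show ?thesis by (simp only: relpow_reflcl_refl)
  qed
  from frege_simulation[OF P E path] obtain \<pi> where \<pi>: "frege_proof Ax {} \<pi> A"
    "length \<pi> \<le> length P * (c * (2 * (2 * Suc i + 1) + 3) + 1)
       + c * ((2 * Suc i + 1) * 4 * (\<Sum>q<n. width ?T q))" by blast
  have "(\<Sum>q<n. width ?T q) \<le> n" using sum_width_le_card[OF T(1), of n] T(2) by linarith
  then have "c * ((2 * Suc i + 1) * 4 * (\<Sum>q<n. width ?T q)) \<le> c * ((2 * Suc i + 1) * 4 * n)"
    by (intro mult_le_mono2)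
  with \<pi>(2) have "length \<pi> \<le> n * (c * (2 * (2 * Suc i + 1) + 3) + 1) + c * ((2 * Suc i + 1) * 4 * n)"
    by (simp only: n_def)
  \<comment> \<open>Per line, \<open>2 * (2 * i + 3) + 3\<close> for the simulation and
    \<open>4 * (2 * i + 3)\<close> for the edges give \<open>12 * i + 21\<close>, which is at most
    \<open>33 * i\<close> since \<open>i \<ge> 1\<close>.\<close>
  also have "\<dots> = n * (c * (12 * i + 21) + 1)" by (simp add: algebra_simps)
  also have "\<dots> \<le> n * (c * (33 * i) + i)"
    using inverse_ackermann_bounds(1)[of n]
    by (intro mult_le_mono2 add_mono) (auto simp: i_def)
  also have "\<dots> = (33 * c + 1) * (n * i)" by (simp add: algebra_simps)
  finally show ?thesis using \<pi>(1) by (auto simp: n_def i_def)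
qed

text \<open>No shortcuts are added: contexts have at most \<open>m\<close> formulas, so parent edges
  reach any ancestor within \<open>m\<close> edges.\<close>

lemma assumption_count_simulation:
  assumes P: "nested_proof Ax P m A"
  shows "\<exists>\<pi>. frege_proof Ax {} \<pi> A \<and> length \<pi> \<le> length P * (c * (2 * m + 3) + 1)"
proof -
  note facts = nested_proof_facts[OF P]
  let ?T = "fst ` set P"
  let ?E = "parent_edges ?T (\<lambda>q. q) (Suc m)"
  have path: "(u, take d u) \<in> (?E\<^sup>=) ^^ m" if u: "u \<in> ?T" for u d
  proof (cases "d < length u")
    case True
    have len: "length u \<le> m" by (rule facts(6)[OF u])
    have "(u, take (length u - (length u - d)) u) \<in> (?E\<^sup>=) ^^ (length u - d)"
      using len by (intro parent_path[OF facts(5) u]) auto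
    then have "(u, take d u) \<in> (?E\<^sup>=) ^^ (length u - d)" using True by simp
    moreover have "length u - d \<le> m" using len by simp
    ultimately show ?thesis using relpow_reflcl_le by blast
  next
    case False
    then have "take d u = u" by simp
    then show ?thesis by (simp only: relpow_reflcl_refl)
  qed
  have "reach compose_rule 0 ?E ?E" by (simp add: reach_refl)
  from frege_simulation[OF P this path] show ?thesis by simp
qed

end

text \<open>The \<open>max 1\<close> covers proofs that open no assumption, where the product is 0
  but the lines still have to be simulated. In the second bound one constant,
  \<open>4 * c + 1\<close>, serves for every \<open>i\<close>.\<close>

theorem theorem14:
  fixes k :: nat and Ax :: "formula set"
  assumes "k \<ge> 2" and "frege_system k Ax"
  shows "(\<exists>c::real. \<forall>P m A. nested_proof Ax P m A \<longrightarrow>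
            (\<exists>\<pi>. frege_proof Ax {} \<pi> A \<and>
               real (length \<pi>) \<le> c * (real (length P) * real (inverse_ackermann (length P)))))
       \<and> (\<forall>i::nat. \<exists>c::real. \<forall>P m A. nested_proof Ax P m A \<longrightarrow>
            (\<exists>\<pi>. frege_proof Ax {} \<pi> A \<and>
               real (length \<pi>) \<le>
                 c * (real (length P) * max 1 (real m * log_star i (real m)))))"
proof -
  obtain c where c: "context_rules Ax (iter_imp k) c" using context_rules_exist[OF assms] by blast
  have 1: "\<exists>\<pi>. frege_proof Ax {} \<pi> A \<and>
      real (length \<pi>) \<le> real (33 * c + 1) * (real (length P) * real (inverse_ackermann (length P)))"
    if P: "nested_proof Ax P m A" for P m A
    using context_rules.inverse_ackermann_simulation[OF c P]
    by (simp only: of_nat_mult[symmetric] of_nat_le_iff)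
  have 2: "\<exists>\<pi>. frege_proof Ax {} \<pi> A \<and>
      real (length \<pi>) \<le> real (4 * c + 1) * (real (length P) * max 1 (real m * log_star i (real m)))"
    if P: "nested_proof Ax P m A" for P m A i
  proof -
    obtain \<pi> where \<pi>: "frege_proof Ax {} \<pi> A" "length \<pi> \<le> length P * (c * (2 * m + 3) + 1)"
      using context_rules.assumption_count_simulation[OF c P] by blast
    let ?b = "max 1 (real m * log_star i (real m))"
    have m: "m = 0 \<or> m \<ge> 2" using nested_proof_facts(4)[OF P] by presburger
    have "real (max 1 m) \<le> ?b"
    proof (cases "m = 0")
      case False
      with m have "real m * 1 \<le> real m * log_star i (real m)"
        by (intro mult_left_mono log_star_ge_1) auto
      then have "real m \<le> ?b" by linarith
      moreover have "max 1 m = m" using False by simp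
      ultimately show ?thesis by (simp only:)
    qed simp
    moreover have "c * (2 * m + 3) + 1 \<le> (4 * c + 1) * max 1 m"
    proof -
      \<comment> \<open>For \<open>m = 0\<close> this rests on \<open>3 \<le> 4\<close>, for
        \<open>m \<ge> 2\<close> on \<open>2 * m + 3 \<le> 4 * m\<close>.\<close>
      have "c * (2 * m + 3) \<le> c * (4 * max 1 m)" using m by (intro mult_le_mono2) auto
      then have "c * (2 * m + 3) + 1 \<le> c * (4 * max 1 m) + max 1 m" by (intro add_mono) auto
      then show ?thesis by (simp add: algebra_simps)
    qed
    then have "real (c * (2 * m + 3) + 1) \<le> real ((4 * c + 1) * max 1 m)" by (simp only: of_nat_le_iff)
    ultimately have "real (c * (2 * m + 3) + 1) \<le> real (4 * c + 1) * ?b"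
      by (smt (verit) mult_left_mono of_nat_0_le_iff of_nat_mult)
    then have "real (length P) * real (c * (2 * m + 3) + 1) \<le> real (length P) * (real (4 * c + 1) * ?b)"
      by (intro mult_left_mono) auto
    moreover have "real (length \<pi>) \<le> real (length P) * real (c * (2 * m + 3) + 1)"
      using \<pi>(2) by (simp only: of_nat_mult[symmetric] of_nat_le_iff)
    ultimately have "real (length \<pi>) \<le> real (4 * c + 1) * (real (length P) * ?b)"
      by (simp only: mult.left_commute)
    then show ?thesis using \<pi>(1) by blast
  qed
  show ?thesis using 1 2 by blast
qed

end
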